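(* Let $\mathcal N$, $\mathcal T$, $G$, $\mathcal B$, $f$, $\boldsymbol f$, $\iota_f$, $\iota_\Delta$ be as in the context. If $N^*(\iota_f)\cap N^*(\iota_\Delta)$ contains no nonzero covectors, then $$\mathrm{Fix}(\boldsymbol f)=\{\mathcal Y\in\mathcal B: f(\mathcal Y)=\mathcal Y\}$$ is a discrete subset of $\mathcal B$.
   Context: $\mathcal N$ is a closed (compact, without boundary) smooth $n$-manifold, $\mathcal T$ is a nowhere vanishing smooth real vector field on $\mathcal N$ that preserves some Riemannian metric $\mathrm g$, with flow $\mathfrak a_t$. $G$ is the closure of $\{\mathfrak a_t:t\in\mathbb R\}$ in the (compact) group of isometries of $\mathrm g$; it is a compact connected abelian Lie group, and $\mathfrak a_g$ denotes the isometry defined by $g\in G$, with $\mathfrak a_{g_1}\circ\mathfrak a_{g_2}=\mathfrak a_{g_1g_2}$. $\mathcal B$ is the space of orbits of $G$ in $\mathcal N$ with the quotient topology. $f:\mathcal N\to\mathcal N$ is a smooth map with $f_*\mathcal T=\mathcal T$ (i.e. $df(\mathcal T(p))=\mathcal T(f(p))$ for all $p$). Then $f$ commutes with every $\mathfrak a_g$, maps $G$-orbits onto $G$-orbits, and induces a continuous map $\boldsymbol f:\mathcal B\to\mathcal B$. The maps $\iota_f:\mathcal N\times G\to\mathcal N\times\mathcal N$ and $\iota_\Delta:\mathcal N\to\mathcal N\times\mathcal N$ are $\iota_f(p,g)=(\mathfrak a_g(p),f(p))$ and $\iota_\Delta(p)=(p,p)$. For a smooth map $\iota:X\to Y$ between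 manifolds, $$N^*(\iota)=\{\eta\in T^*Y:\ \exists x\in X\text{ such that }\eta\in T^*_{\iota(x)}Y\text{ and }\iota^*\eta=0\in T^*_xX\}.$$ *)

theory Defs
  imports "HOL-Analysis.Analysis" "HOL-Algebra.Bij"
begin

section \<open>Smooth maps between Euclidean spaces\<close>

text \<open>
  Both predicates are meant for open \<open>S\<close>.  In finite dimension a function is of class \<open>C\<^sup>k\<^sup>+\<^sup>1\<close> iff
  it is differentiable and all its directional derivatives are of class \<open>C\<^sup>k\<close>.
\<close>

primrec ck_on ::
    "nat \<Rightarrow> 'e::euclidean_space set \<Rightarrow> ('e \<Rightarrow> 'f::real_normed_vector) \<Rightarrow> bool" where
  "ck_on 0 S h \<longleftrightarrow> continuous_on S h"
| "ck_on (Suc k) S h \<longleftrightarrow>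
     (\<forall>x\<in>S. h differentiable (at x)) \<and> (\<forall>v. ck_on k S (\<lambda>x. frechet_derivative h (at x) v))"

definition smooth_on :: "'e::euclidean_space set \<Rightarrow> ('e \<Rightarrow> 'f::real_normed_vector) \<Rightarrow> bool" where
  "smooth_on S h \<longleftrightarrow> (\<forall>k. ck_on k S h)"


section \<open>Smooth manifolds\<close>

text \<open>
  A chart is a domain together with a coordinate map; the values of the coordinate map outside the
  domain are irrelevant.  The dimension of the manifold is \<open>DIM('e)\<close>.  The atlas need not be maximal.
\<close>

type_synonym ('a, 'e) chart = "'a set \<times> ('a \<Rightarrow> 'e)"

record ('a, 'e) manifold =
  mtop :: "'a topology"
  charts :: "('a, 'e) chart set"

abbreviation points :: "('a, 'e) manifold \<Rightarrow> 'a set" where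
  "points M \<equiv> topspace (mtop M)"

abbreviation cdom :: "('a, 'e) chart \<Rightarrow> 'a set" where
  "cdom c \<equiv> fst c"

abbreviation cmap :: "('a, 'e) chart \<Rightarrow> 'a \<Rightarrow> 'e" where
  "cmap c \<equiv> snd c"

definition cinv :: "('a, 'e) chart \<Rightarrow> 'e \<Rightarrow> 'a" where
  "cinv c = inv_into (cdom c) (cmap c)"

definition charts_at :: "('a, 'e) manifold \<Rightarrow> 'a \<Rightarrow> ('a, 'e) chart set" where
  "charts_at M p = {c \<in> charts M. p \<in> cdom c}"

definition smooth_manifold :: "('a, 'e::euclidean_space) manifold \<Rightarrow> bool" where
  "smooth_manifold M \<longleftrightarrow>
     Hausdorff_space (mtop M) \<and> second_countable (mtop M) \<and>
     (\<Union>c\<in>charts M. cdom c) = points M \<and>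
     (\<forall>c\<in>charts M. openin (mtop M) (cdom c) \<and> open (cmap c ` cdom c) \<and>
        homeomorphic_map (subtopology (mtop M) (cdom c)) (top_of_set (cmap c ` cdom c)) (cmap c)) \<and>
     (\<forall>c\<in>charts M. \<forall>c'\<in>charts M.
        smooth_on (cmap c ` (cdom c \<inter> cdom c')) (cmap c' \<circ> cinv c))"

definition closed_manifold :: "('a, 'e::euclidean_space) manifold \<Rightarrow> bool" where
  "closed_manifold M \<longleftrightarrow> smooth_manifold M \<and> compact_space (mtop M)"

definition product_manifold ::
    "('a, 'e) manifold \<Rightarrow> ('b, 'f) manifold \<Rightarrow> ('a \<times> 'b, 'e \<times> 'f) manifold" where
  "product_manifold M M' =
     \<lparr>mtop = prod_topology (mtop M) (mtop M'),
      charts = {(cdom c \<times> cdom c', map_prod (cmap c) (cmap c')) | c c'.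
                  c \<in> charts M \<and> c' \<in> charts M'}\<rparr>"

definition smooth_map ::
    "('a, 'e::euclidean_space) manifold \<Rightarrow> ('b, 'f::euclidean_space) manifold \<Rightarrow> ('a \<Rightarrow> 'b) \<Rightarrow> bool"
  where
  "smooth_map M M' F \<longleftrightarrow>
     continuous_map (mtop M) (mtop M') F \<and>
     (\<forall>c\<in>charts M. \<forall>c'\<in>charts M'.
        smooth_on (cmap c ` {p \<in> cdom c. F p \<in> cdom c'}) (cmap c' \<circ> F \<circ> cinv c))"


section \<open>Tangent vectors, covectors and conormal sets\<close>

text \<open>
  A tangent vector at \<open>p\<close> is the family of its coordinate vectors in all charts around \<open>p\<close>, related
  by the derivatives of the transition maps (and \<open>0\<close> at all other charts, so that equal tangent
  vectors are equal as functions).  The vector space operations are pointwise.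
\<close>

type_synonym ('a, 'e) tvec = "('a, 'e) chart \<Rightarrow> 'e"

definition tangent_space :: "('a, 'e::euclidean_space) manifold \<Rightarrow> 'a \<Rightarrow> ('a, 'e) tvec set" where
  "tangent_space M p =
     {v. (\<forall>c\<in>charts_at M p. \<forall>c'\<in>charts_at M p.
            v c' = frechet_derivative (cmap c' \<circ> cinv c) (at (cmap c p)) (v c)) \<and>
         (\<forall>c. c \<notin> charts_at M p \<longrightarrow> v c = 0)}"

definition coord_vec :: "('a, 'e::euclidean_space) manifold \<Rightarrow> ('a, 'e) chart \<Rightarrow> 'a \<Rightarrow> 'e \<Rightarrow> ('a, 'e) tvec"
  where
  "coord_vec M c p u =
     (\<lambda>c'. if c' \<in> charts_at M p
           then frechet_derivative (cmap c' \<circ> cinv c) (at (cmap c p)) u else 0)"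

text \<open>The differential does not depend on the chart around \<open>p\<close> used to compute it.\<close>

definition differential ::
    "('a, 'e::euclidean_space) manifold \<Rightarrow> ('b, 'f::euclidean_space) manifold \<Rightarrow> ('a \<Rightarrow> 'b) \<Rightarrow> 'a \<Rightarrow>
     ('a, 'e) tvec \<Rightarrow> ('b, 'f) tvec" where
  "differential M M' F p v =
     (let c = (SOME c. c \<in> charts_at M p) in
        (\<lambda>c'. if c' \<in> charts_at M' (F p)
              then frechet_derivative (cmap c' \<circ> F \<circ> cinv c) (at (cmap c p)) (v c) else 0))"

definition linear_functional_on :: "('a, 'e::euclidean_space) tvec set \<Rightarrow> (('a, 'e) tvec \<Rightarrow> real) \<Rightarrow> bool"
  where
  "linear_functional_on V l \<longleftrightarrow>
     (\<forall>v\<in>V. \<forall>w\<in>V. \<forall>a b. l (\<lambda>c. a *\<^sub>R v c + b *\<^sub>R w c) = a * l v + b * l w)"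

definition cotangent_space ::
    "('a, 'e::euclidean_space) manifold \<Rightarrow> 'a \<Rightarrow> (('a, 'e) tvec \<Rightarrow> real) set" where
  "cotangent_space M p =
     {\<eta>. linear_functional_on (tangent_space M p) \<eta> \<and> (\<forall>v. v \<notin> tangent_space M p \<longrightarrow> \<eta> v = 0)}"

definition pullback_covector ::
    "('a, 'e::euclidean_space) manifold \<Rightarrow> ('b, 'f::euclidean_space) manifold \<Rightarrow> ('a \<Rightarrow> 'b) \<Rightarrow> 'a \<Rightarrow>
     (('b, 'f) tvec \<Rightarrow> real) \<Rightarrow> (('a, 'e) tvec \<Rightarrow> real)" where
  "pullback_covector M M' F p \<eta> =
     (\<lambda>v. if v \<in> tangent_space M p then \<eta> (differential M M' F p v) else 0)"

text \<open>Elements of the cotangent bundle are pairs of a base point and a covector at that point.\<close>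

definition conormal ::
    "('a, 'e::euclidean_space) manifold \<Rightarrow> ('b, 'f::euclidean_space) manifold \<Rightarrow> ('a \<Rightarrow> 'b) \<Rightarrow>
     ('b \<times> (('b, 'f) tvec \<Rightarrow> real)) set" where
  "conormal X Y \<iota> =
     {(y, \<eta>). \<eta> \<in> cotangent_space Y y \<and>
        (\<exists>x\<in>points X. y = \<iota> x \<and> pullback_covector X Y \<iota> x \<eta> = (\<lambda>_. 0))}"


section \<open>Vector fields, flows and Riemannian metrics\<close>

definition smooth_vector_field ::
    "('a, 'e::euclidean_space) manifold \<Rightarrow> ('a \<Rightarrow> ('a, 'e) tvec) \<Rightarrow> bool" where
  "smooth_vector_field M T \<longleftrightarrow>
     (\<forall>p\<in>points M. T p \<in> tangent_space M p) \<and>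
     (\<forall>c\<in>charts M. smooth_on (cmap c ` cdom c) (\<lambda>x. T (cinv c x) c))"

definition global_flow ::
    "('a, 'e::euclidean_space) manifold \<Rightarrow> ('a \<Rightarrow> ('a, 'e) tvec) \<Rightarrow> (real \<Rightarrow> 'a \<Rightarrow> 'a) \<Rightarrow> bool" where
  "global_flow M T \<Phi> \<longleftrightarrow>
     (\<forall>p\<in>points M. \<Phi> 0 p = p \<and> continuous_map euclideanreal (mtop M) (\<lambda>t. \<Phi> t p) \<and>
        (\<forall>t. \<forall>c\<in>charts_at M (\<Phi> t p).
           ((\<lambda>s. cmap c (\<Phi> s p)) has_vector_derivative T (\<Phi> t p) c) (at t)))"

definition riemannian_metric ::
    "('a, 'e::euclidean_space) manifold \<Rightarrow> ('a \<Rightarrow> ('a, 'e) tvec \<Rightarrow> ('a, 'e) tvec \<Rightarrow> real) \<Rightarrow> bool"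
  where
  "riemannian_metric M \<g> \<longleftrightarrow>
     (\<forall>p\<in>points M. \<forall>v\<in>tangent_space M p.
        linear_functional_on (tangent_space M p) (\<g> p v) \<and>
        (\<forall>w\<in>tangent_space M p. \<g> p v w = \<g> p w v) \<and>
        (v \<noteq> (\<lambda>_. 0) \<longrightarrow> \<g> p v v > 0)) \<and>
     (\<forall>c\<in>charts M. \<forall>u w. smooth_on (cmap c ` cdom c)
        (\<lambda>x. \<g> (cinv c x) (coord_vec M c (cinv c x) u) (coord_vec M c (cinv c x) w)))"

text \<open>
  Self-maps are normalised to be \<open>undefined\<close> off the manifold, as in \<^const>\<open>Bij\<close>, so that equality
  of maps is equality of functions.
\<close>

definition isometries ::
    "('a, 'e::euclidean_space) manifold \<Rightarrow> ('a \<Rightarrow> ('a, 'e) tvec \<Rightarrow> ('a, 'e) tvec \<Rightarrow> real) \<Rightarrow> ('a \<Rightarrow> 'a) set"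
  where
  "isometries M \<g> =
     {\<phi> \<in> Bij (points M).
        smooth_map M M \<phi> \<and> smooth_map M M (inv_into (points M) \<phi>) \<and>
        (\<forall>p\<in>points M. \<forall>v\<in>tangent_space M p. \<forall>w\<in>tangent_space M p.
           \<g> (\<phi> p) (differential M M \<phi> p v) (differential M M \<phi> p w) = \<g> p v w)}"

definition compact_open_topology :: "'a topology \<Rightarrow> 'b topology \<Rightarrow> ('a \<Rightarrow> 'b) topology" where
  "compact_open_topology X Y =
     topology_generated_by
       {{h \<in> extensional (topspace X). continuous_map X Y h \<and> h ` K \<subseteq> U} | K U.
          compactin X K \<and> openin Y U}"

text \<open>
  On an isometry group the compact-open topology is the usual one; it coincides with the topology of
  uniform convergence and with the one of smooth convergence.
\<close>

definition isometry_topology ::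
    "('a, 'e::euclidean_space) manifold \<Rightarrow> ('a \<Rightarrow> ('a, 'e) tvec \<Rightarrow> ('a, 'e) tvec \<Rightarrow> real) \<Rightarrow> ('a \<Rightarrow> 'a) topology"
  where
  "isometry_topology M \<g> =
     subtopology (compact_open_topology (mtop M) (mtop M)) (isometries M \<g>)"

definition flow_closure ::
    "('a, 'e::euclidean_space) manifold \<Rightarrow> ('a \<Rightarrow> ('a, 'e) tvec \<Rightarrow> ('a, 'e) tvec \<Rightarrow> real) \<Rightarrow>
     (real \<Rightarrow> 'a \<Rightarrow> 'a) \<Rightarrow> ('a \<Rightarrow> 'a) set" where
  "flow_closure M \<g> \<Phi> =
     isometry_topology M \<g> closure_of range (\<lambda>t. restrict (\<Phi> t) (points M))"


section \<open>Lie groups and orbit spaces\<close>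

definition lie_group :: "('g, 'm) monoid_scheme \<Rightarrow> ('g, 'h::euclidean_space) manifold \<Rightarrow> bool" where
  "lie_group \<Gamma> M \<longleftrightarrow>
     group \<Gamma> \<and> smooth_manifold M \<and> points M = carrier \<Gamma> \<and>
     smooth_map (product_manifold M M) M (\<lambda>(x, y). x \<otimes>\<^bsub>\<Gamma>\<^esub> y) \<and>
     smooth_map M M (\<lambda>x. inv\<^bsub>\<Gamma>\<^esub> x)"

definition orbits :: "'a topology \<Rightarrow> ('a \<Rightarrow> 'a) set \<Rightarrow> 'a set set" where
  "orbits X G = (\<lambda>p. (\<lambda>g. g p) ` G) ` topspace X"

definition orbit_space :: "'a topology \<Rightarrow> ('a \<Rightarrow> 'a) set \<Rightarrow> 'a set topology" where
  "orbit_space X G =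
     topology (\<lambda>W. W \<subseteq> orbits X G \<and> openin X {p \<in> topspace X. (\<lambda>g. g p) ` G \<in> W})"

lemma openin_orbit_space:
  "openin (orbit_space X G) W \<longleftrightarrow>
     W \<subseteq> orbits X G \<and> openin X {p \<in> topspace X. (\<lambda>g. g p) ` G \<in> W}"
proof -
  let ?q = "\<lambda>p. (\<lambda>g. g p) ` G"
  have "istopology (\<lambda>W. W \<subseteq> orbits X G \<and> openin X {p \<in> topspace X. ?q p \<in> W})"
    unfolding istopology_def
  proof (intro conjI allI impI)
    fix S T
    assume S: "S \<subseteq> orbits X G \<and> openin X {p \<in> topspace X. ?q p \<in> S}"
      and T: "T \<subseteq> orbits X G \<and> openin X {p \<in> topspace X. ?q p \<in> T}"
    show "S \<inter> T \<subseteq> orbits X G" using S by blast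
    have "{p \<in> topspace X. ?q p \<in> S \<inter> T} =
        {p \<in> topspace X. ?q p \<in> S} \<inter> {p \<in> topspace X. ?q p \<in> T}" by blast
    then show "openin X {p \<in> topspace X. ?q p \<in> S \<inter> T}"
      using S T by (simp add: openin_Int)
  next
    fix \<K>
    assume K: "\<forall>K\<in>\<K>. K \<subseteq> orbits X G \<and> openin X {p \<in> topspace X. ?q p \<in> K}"
    show "\<Union>\<K> \<subseteq> orbits X G" using K by blast
    have "{p \<in> topspace X. ?q p \<in> \<Union>\<K>} = (\<Union>K\<in>\<K>. {p \<in> topspace X. ?q p \<in> K})" by blast
    moreover have "openin X (\<Union>K\<in>\<K>. {p \<in> topspace X. ?q p \<in> K})"
      using K by (intro openin_Union) blast
    ultimately show "openin X {p \<in> topspace X. ?q p \<in> \<Union>\<K>}" by simp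
  qed
  then show ?thesis
    by (simp add: orbit_space_def)
qed

lemma topspace_orbit_space: "topspace (orbit_space X G) = orbits X G"
proof
  show "topspace (orbit_space X G) \<subseteq> orbits X G"
    by (auto simp: topspace_def openin_orbit_space)
  have "{p \<in> topspace X. (\<lambda>g. g p) ` G \<in> orbits X G} = topspace X"
    by (auto simp: orbits_def)
  then have "openin (orbit_space X G) (orbits X G)"
    by (simp add: openin_orbit_space)
  then show "orbits X G \<subseteq> topspace (orbit_space X G)"
    by (rule openin_subset)
qed

lemma quotient_map_orbit_space: "quotient_map X (orbit_space X G) (\<lambda>p. (\<lambda>g. g p) ` G)"
  unfolding quotient_map_def topspace_orbit_space openin_orbit_space
  by (auto simp: orbits_def)

end

theory Submission
  imports Defs
begin

text \<open>
  A fixed orbit through \<open>p\<^sub>0\<close> yields zeros \<open>(p\<^sub>0, g\<^sub>0)\<close> of the defect \<open>(p, g) \<mapsto> g p - f p\<close> (in charts).  By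
  transversality the differential of the defect is onto there, so the zero set is near \<open>(p\<^sub>0, g\<^sub>0)\<close> a
  manifold of dimension \<open>dim G\<close> and any nearby zero can be joined to \<open>(p\<^sub>0, g\<^sub>0)\<close> by a smooth path of
  zeros.  As \<open>f\<close> commutes with \<open>G\<close>, the kernel of the differential at a zero \<open>(p, g)\<close> contains the
  tangent space of the orbit of \<open>p\<close> times that of the stabilizer of \<open>p\<close>, which already has dimension
  \<open>dim G\<close>.  Hence the path is tangent to orbits and every \<open>G\<close>-invariant locally Lipschitz function is
  constant along it; since such functions separate orbits, the path stays in the orbit of \<open>p\<^sub>0\<close>.
  Compactness of \<open>G\<close> makes the neighbourhood of \<open>p\<^sub>0\<close> uniform in \<open>g\<^sub>0\<close>.
\<close>

section \<open>Calculus and linear algebra\<close>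

text \<open>Orbits may have varying dimension, so the directions tangent to them need not have
  constant rank and a path with such velocities cannot simply be placed in a leaf of a foliation.
  Hence the detour through invariant functions; those built here are suprema of bumps over orbits,
  which are Lipschitz in charts but in general not differentiable.

  Transversality becomes surjectivity as follows: a covector at \<open>(q, q)\<close> killed by the
  diagonal has the form \<open>(\<xi>, -\<xi>)\<close>, and its pullback by
  \<open>(p, g) \<mapsto> (g p, f p)\<close> is \<xi> applied to the differential of the defect.

  The dimension count works for every orbit: \<open>dim G\<close> is the rank plus the nullity of
  the differential of \<open>g \<mapsto> g p\<close>, the rank being the dimension of the orbit and
  the nullity that of the stabilizer.

  A fixed orbit near \<open>p0\<close> only gives \<open>f p = g p\<close> for some \<open>g\<close>
  of the group, possibly far from \<open>g0\<close>. This is why all of the group has to be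
  examined, including the elements with \<open>g p0 \<noteq> f p0\<close>.\<close>

lemma smooth_on_C1:
  assumes "smooth_on S h"
  obtains h' where "\<And>x. x \<in> S \<Longrightarrow> (h has_derivative blinfun_apply (h' x)) (at x)"
    and "continuous_on S h'"
proof
  have "ck_on (Suc (Suc 0)) S h"
    using assms by (simp only: smooth_on_def)
  then have diff: "\<And>x. x \<in> S \<Longrightarrow> h differentiable (at x)"
    and cont: "\<And>v. continuous_on S (\<lambda>x. frechet_derivative h (at x) v)"
    using assms[unfolded smooth_on_def, rule_format, of "Suc 0"] by simp_all
  define h' where "h' x = Blinfun (frechet_derivative h (at x))" for x
  have D: "(h has_derivative frechet_derivative h (at x)) (at x)" if "x \<in> S" for x
    using diff[OF that] by (simp add: frechet_derivative_works)
  then have app: "blinfun_apply (h' x) = frechet_derivative h (at x)" if "x \<in> S" for x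
    unfolding h'_def using that by (intro bounded_linear_Blinfun_apply) (auto dest: has_derivative_bounded_linear)
  show "(h has_derivative blinfun_apply (h' x)) (at x)" if "x \<in> S" for x
    using D[OF that] app[OF that] by simp
  show "continuous_on S h'"
  \<comment> \<open>\<open>ck_on\<close> only provides continuity of each directional derivative; in
    finite dimension continuity in every basis direction is continuity in operator norm, the form
    that the inverse function theorem asks for.\<close>
  proof (rule continuous_on_blinfun_componentwise)
    fix i :: 'a
    show "continuous_on S (\<lambda>x. blinfun_apply (h' x) i)"
      using cont[of i] by (rule continuous_on_eq) (simp add: app)
  qed
qed

lemma smooth_on_local_lipschitz:
  assumes "smooth_on S h" "open S" "x0 \<in> S"
  obtains e C where "e > 0" "C > 0" "ball x0 e \<subseteq> S"
    "\<And>x x'. x \<in> ball x0 e \<Longrightarrow> x' \<in> ball x0 e \<Longrightarrow> norm (h x - h x') \<le> C * norm (x - x')"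
proof -
  obtain h' where h': "\<And>x. x \<in> S \<Longrightarrow> (h has_derivative blinfun_apply (h' x)) (at x)"
    and cont: "continuous_on S h'"
    using smooth_on_C1[OF assms(1)] by blast
  obtain e1 where e1: "e1 > 0" "ball x0 e1 \<subseteq> S"
    using assms openE by blast
  have "continuous (at x0) h'"
    using cont assms continuous_on_eq_continuous_at by blast
  then obtain e2 where e2: "e2 > 0" "\<And>x. dist x x0 < e2 \<Longrightarrow> dist (h' x) (h' x0) < 1"
    unfolding continuous_at_eps_delta by (meson zero_less_one)
  define e where "e = min e1 e2"
  \<comment> \<open>The derivative moves by less than 1 on the ball, which is convex, so the mean
    value inequality applies with this bound; adding 1 also keeps it positive when
    \<open>h' x0 = 0\<close>.\<close>
  define C where "C = norm (h' x0) + 1"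
  show thesis
  proof
    show "e > 0" "C > 0" "ball x0 e \<subseteq> S"
      using e1 e2 by (auto simp: e_def C_def add_nonneg_pos)
    fix x x' assume x: "x \<in> ball x0 e" "x' \<in> ball x0 e"
    show "norm (h x - h x') \<le> C * norm (x - x')"
    proof (rule differentiable_bound[of "ball x0 e" h "\<lambda>x. blinfun_apply (h' x)"])
      fix z assume z: "z \<in> ball x0 e"
      then have "z \<in> S" using e1 by (auto simp: e_def)
      then show "(h has_derivative blinfun_apply (h' z)) (at z within ball x0 e)"
        using h' has_derivative_at_withinI by blast
      have "dist (h' z) (h' x0) < 1"
        using z by (intro e2) (simp add: e_def dist_commute)
      then have "norm (h' z) \<le> C"
        unfolding C_def dist_norm using norm_triangle_ineq2[of "h' z" "h' x0"] by linarith
      then show "onorm (blinfun_apply (h' z)) \<le> C"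
        by (simp add: norm_blinfun.rep_eq)
    qed (use x in auto)
  qed
qed

section \<open>Kernels of linear maps and their dimensions\<close>

lemma dim_kernel_plus_dim_range:
  fixes L :: "'a::euclidean_space \<Rightarrow> 'b::euclidean_space"
  assumes "linear L"
  shows "dim {x. L x = 0} + dim (range L) = DIM('a)"
proof -
  interpret linear L by fact
  define K where "K = {x. L x = 0}"
  define C where "C = {y. \<forall>x\<in>K. orthogonal x y}"
  have subK: "subspace K"
    unfolding K_def by (rule linear_subspace_kernel[OF assms])
  have subC: "subspace C"
    unfolding C_def by (rule subspace_orthogonal_to_vectors)
  have dims: "dim C + dim K = DIM('a)"
    using dim_subspace_orthogonal_to_vectors[of K UNIV] subK by (simp add: C_def)
  have inj: "inj_on L C"
  proof (rule inj_onI)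
    fix x y assume "x \<in> C" "y \<in> C" "L x = L y"
    then have "x - y \<in> C" "x - y \<in> K"
      using subC by (auto simp: subspace_diff K_def diff)
    then have "orthogonal (x - y) (x - y)" by (auto simp: C_def)
    then show "x = y" by (simp add: orthogonal_def)
  qed
  have "range L \<subseteq> L ` C"
  proof clarify
    fix x
    obtain k c where kc: "k \<in> span K" "\<And>w. w \<in> span K \<Longrightarrow> orthogonal c w" "x = k + c"
      using orthogonal_subspace_decomp_exists[of K x] by metis
    have "k \<in> K" using kc(1) subK by (metis span_eq_iff)
    then have "L x = L c" using kc(3) by (simp add: K_def add)
    moreover have "c \<in> C"
      using kc(2) by (auto simp: C_def orthogonal_commute span_base)
    ultimately have "L x = L c" "c \<in> C" by auto
    then show "L x \<in> L ` C" by blast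
  qed
  then have "range L = L ` C" by blast
  moreover have "dim (L ` C) = dim C"
    using inj subC by (intro dim_image_eq assms) (simp add: span_eq_iff[THEN iffD2])
  ultimately show ?thesis
    using dims by (simp add: K_def)
qed

text \<open>In the application \<open>L\<close> is the differential of the defect at a zero
  \<open>(p, g)\<close>, \<open>a\<close> that of the orbit map \<open>g \<mapsto> g p\<close>, and
  \<open>M\<close> that of the translation by the inverse of \<open>g\<close>, which carries orbit
  tangents from \<open>g p\<close> back to \<open>p\<close>. The product of
  \<open>M (range a)\<close> and the kernel of \<open>a\<close> lies in the kernel of
  \<open>L\<close>. Its dimension is rank plus nullity of \<open>a\<close>, thus
  \<open>DIM('b)\<close>, and surjectivity of \<open>L\<close> gives the kernel of \<open>L\<close>
  the same dimension, so the two agree.\<close>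

lemma kernel_fst_tangent:
  fixes L :: "'a::euclidean_space \<times> 'b::euclidean_space \<Rightarrow> 'a" and a :: "'b \<Rightarrow> 'a" and M :: "'a \<Rightarrow> 'a"
  assumes L: "linear L" "surj L" and a: "\<And>v. L (0, v) = a v"
    and M: "linear M" "inj M" "\<And>v. L (M (a v), 0) = 0"
    and z: "L (u, w) = 0"
  obtains v where "u = M (a v)"
proof -
  have lina: "linear a"
  proof -
    have "linear (L \<circ> (\<lambda>v. (0, v)))"
      by (intro linear_compose L) (auto intro!: linearI)
    then show ?thesis by (simp add: a comp_def)
  qed
  define W where "W = (M ` range a) \<times> {v. a v = 0}"
  have sub: "subspace W"
    unfolding W_def using lina M(1)
    by (intro subspace_Times linear_subspace_image linear_subspace_kernel) auto
  have "W \<subseteq> {z. L z = 0}"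
  proof
    fix z assume "z \<in> W"
    then obtain v k where z: "z = (M (a v), k)" "a k = 0"
      by (auto simp: W_def)
    then have "z = (M (a v), 0) + (0, k)" by simp
    then have "L z = L (M (a v), 0) + L (0, k)"
      using linear_add[OF L(1)] by metis
    then show "z \<in> {z. L z = 0}"
      using M a z by simp
  qed
  moreover have "dim W \<ge> dim {z. L z = 0}"
  proof -
    have "dim W = dim (range a) + dim {v. a v = 0}"
      unfolding W_def using lina M(1) dim_image_eq[OF M(1), of "range a"] inj_on_subset[OF M(2) subset_UNIV]
      by (subst dim_Times) (simp_all add: linear_subspace_image linear_subspace_kernel)
    also have "\<dots> = DIM('b)"
      using dim_kernel_plus_dim_range[OF lina] by simp
    also have "\<dots> = dim {z. L z = 0}"
      using dim_kernel_plus_dim_range[OF L(1)] L(2) by simp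
    finally show ?thesis by simp
  qed
  ultimately have "W = {z. L z = 0}"
    using subspace_dim_equal[OF sub linear_subspace_kernel[OF L(1)]] by simp
  then show thesis
    using z that by (auto simp: W_def)
qed

text \<open>The kernel of a surjection onto \<open>'a\<close> has the dimension of
  \<open>'b\<close>, so a linear map \<open>P\<close> on the whole product can identify it with
  \<open>'b\<close>; \<open>L\<close> and \<open>P\<close> together then have trivial kernel. This
  supplies the remaining coordinates for the implicit function theorem.\<close>

lemma surjective_linear_complement:
  fixes L :: "'a::euclidean_space \<times> 'b::euclidean_space \<Rightarrow> 'a"
  assumes L: "linear L" "surj L"
  obtains P :: "'a \<times> 'b \<Rightarrow> 'b" where "linear P" "inj (\<lambda>z. (L z, P z))"
proof -
  have "dim {z. L z = 0} = dim (UNIV :: 'b set)"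
    using dim_kernel_plus_dim_range[OF L(1)] L(2) by simp
  then obtain P :: "'a \<times> 'b \<Rightarrow> 'b" and Q
    where P: "linear P" "linear Q" "\<And>z. z \<in> {z. L z = 0} \<Longrightarrow> Q (P z) = z"
    by (rule isometries_subspaces[OF linear_subspace_kernel[OF L(1)] subspace_UNIV]) (rule that)
  have "linear (\<lambda>z. (L z, P z))"
    by (intro linearI) (simp_all only: linear_add[OF L(1)] linear_add[OF P(1)] linear_scale[OF L(1)]
        linear_scale[OF P(1)] add_Pair scaleR_Pair)
  moreover have "z = 0" if "(L z, P z) = 0" for z
    using that P(3)[of z] linear_0[OF P(2)] by (simp add: zero_prod_def)
  ultimately have "inj (\<lambda>z. (L z, P z))"
    using linear_injective_0 by blast
  with P show thesis using that by blast
qed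

text \<open>The implicit function theorem in the form needed: complete \<open>F\<close> to a local diffeomorphism \<open>(F, P)\<close>
  and pull back straight segments.\<close>

lemma zero_set_path:
  fixes F :: "'a::euclidean_space \<times> 'b::euclidean_space \<Rightarrow> 'a"
    and F' :: "'a \<times> 'b \<Rightarrow> ('a \<times> 'b) \<Rightarrow>\<^sub>L 'a"
  assumes Om: "open \<Omega>" "z0 \<in> \<Omega>"
    and F': "\<And>z. z \<in> \<Omega> \<Longrightarrow> (F has_derivative blinfun_apply (F' z)) (at z)" "continuous_on \<Omega> F'"
    and surj: "surj (blinfun_apply (F' z0))" and z0: "F z0 = 0"
  obtains U where "open U" "z0 \<in> U" "U \<subseteq> \<Omega>" "\<And>z. z \<in> U \<Longrightarrow> surj (blinfun_apply (F' z))"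
    "\<And>z. z \<in> U \<Longrightarrow> F z = 0 \<Longrightarrow>
       \<exists>\<gamma> \<gamma>'. \<gamma> 0 = z0 \<and> \<gamma> 1 = z \<and>
         (\<forall>t\<in>{0..1}. \<gamma> t \<in> U \<and> F (\<gamma> t) = 0 \<and> (\<gamma> has_vector_derivative \<gamma>' t) (at t within {0..1::real}))"
proof -
  obtain P :: "'a \<times> 'b \<Rightarrow> 'b" where P: "linear P" "inj (\<lambda>z. (F' z0 z, P z))"
    using surjective_linear_complement[OF blinfun.bounded_linear_right[THEN bounded_linear.linear] surj] by blast
  have bP: "bounded_linear P" using P(1) by (simp add: linear_conv_bounded_linear)
  define \<Psi> where "\<Psi> z = (F z, P z)" for z
  define inl :: "'a \<Rightarrow>\<^sub>L ('a \<times> 'b)" where "inl = Blinfun (\<lambda>a. (a, 0))"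
  define inr :: "('a \<times> 'b) \<Rightarrow>\<^sub>L ('a \<times> 'b)" where "inr = Blinfun (\<lambda>z. (0, P z))"
  define \<Psi>' where "\<Psi>' z = (inl o\<^sub>L F' z) + inr" for z
  have "bounded_linear (\<lambda>a::'a. (a, 0::'b))"
    by (intro bounded_linear_Pair bounded_linear_ident bounded_linear_zero)
  then have inl: "blinfun_apply inl = (\<lambda>a. (a, 0))"
    by (simp add: inl_def bounded_linear_Blinfun_apply)
  have "bounded_linear (\<lambda>z. (0::'a, P z))"
    by (intro bounded_linear_Pair bP bounded_linear_zero)
  then have inr: "blinfun_apply inr = (\<lambda>z. (0, P z))"
    by (simp add: inr_def bounded_linear_Blinfun_apply)
  have app: "blinfun_apply (\<Psi>' z) = (\<lambda>v. (F' z v, P v))" for z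
    by (auto simp: \<Psi>'_def inl inr blinfun.add_left fun_eq_iff)
  have der: "(\<Psi> has_derivative blinfun_apply (\<Psi>' z)) (at z)" if "z \<in> \<Omega>" for z
    unfolding \<Psi>_def[abs_def] app
    by (intro has_derivative_Pair F' that bounded_linear_imp_has_derivative bP)
  have cont: "continuous_on \<Omega> \<Psi>'"
    unfolding \<Psi>'_def by (intro continuous_intros F')
  have "inj (blinfun_apply (\<Psi>' z0))" using P(2) app by simp
  then obtain q where q: "linear q" "q \<circ> blinfun_apply (\<Psi>' z0) = id"
    using linear_injective_left_inverse[OF blinfun.bounded_linear_right[THEN bounded_linear.linear]] by blast
  have "Blinfun q o\<^sub>L \<Psi>' z0 = id_blinfun"
    using q by (intro blinfun_eqI) (simp add: bounded_linear_Blinfun_apply linear_conv_bounded_linear pointfree_idE)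
  note inv = inverse_function_theorem[OF Om(1) der cont Om(2) this]
  obtain U V g g' where UV: "open U" "U \<subseteq> \<Omega>" "z0 \<in> U" "open V" "\<Psi> z0 \<in> V" and
    hom: "homeomorphism U V \<Psi> g" and g: "\<And>y. y \<in> V \<Longrightarrow> (g has_derivative (g' y)) (at y)"
    and bij: "\<And>y. y \<in> V \<Longrightarrow> bij (blinfun_apply (\<Psi>' (g y)))"
    by (rule inv) (assumption | rule that)+
  obtain e where e: "e > 0" "ball (\<Psi> z0) e \<subseteq> V"
    using UV openE by blast
  \<comment> \<open>Shrinking to the preimage of a ball makes the image under \<Psi> convex, so that
    the segment from \<open>\<Psi> z0\<close> to \<open>\<Psi> z\<close> can be pulled back by
    \<open>g\<close>.\<close>
  define U' where "U' = g ` ball (\<Psi> z0) e"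
  have gV: "g y \<in> U" "\<Psi> (g y) = y" if "y \<in> V" for y
    using hom that by (auto simp: homeomorphism_def)
  have gU: "\<Psi> z \<in> V" "g (\<Psi> z) = z" if "z \<in> U" for z
    using hom that by (auto simp: homeomorphism_def)
  have U': "U' = {z \<in> U. \<Psi> z \<in> ball (\<Psi> z0) e}"
  proof (intro equalityI subsetI)
    fix z assume "z \<in> U'"
    then obtain y where y: "y \<in> ball (\<Psi> z0) e" "z = g y" by (auto simp: U'_def)
    then have "y \<in> V" using e(2) by blast
    then show "z \<in> {z \<in> U. \<Psi> z \<in> ball (\<Psi> z0) e}"
      using gV[OF \<open>y \<in> V\<close>] y by simp
  next
    fix z assume "z \<in> {z \<in> U. \<Psi> z \<in> ball (\<Psi> z0) e}"
    then have "z = g (\<Psi> z)" "\<Psi> z \<in> ball (\<Psi> z0) e" using gU(2)[of z] by simp_all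
    then show "z \<in> U'" unfolding U'_def by (rule image_eqI)
  qed
  show thesis
  proof
    have "continuous_on U \<Psi>" using hom by (simp add: homeomorphism_def)
    then have "open (U \<inter> \<Psi> -` ball (\<Psi> z0) e)"
      using UV(1) by (rule continuous_open_preimage) auto
    moreover have "U' = U \<inter> \<Psi> -` ball (\<Psi> z0) e" using U' by auto
    ultimately show "open U'" by simp
    show "z0 \<in> U'" using U' UV e by simp
    show "U' \<subseteq> \<Omega>" using U' UV by auto
  next
    fix z assume "z \<in> U'"
    then have "bij (blinfun_apply (\<Psi>' z))"
      using U' gU bij by (metis (no_types, lifting) mem_Collect_eq)
    \<comment> \<open>Surjectivity is wanted on all of \<open>U'\<close>, since the kernel will be
      analysed along a whole path and not only at \<open>z0\<close>. It is inherited from the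
      invertibility of the completed differential.\<close>
    then have "surj (\<lambda>v. (F' z v, P v))" by (simp add: app bij_is_surj)
    then have "surj (fst \<circ> (\<lambda>v. (F' z v, P v)))"
      by (intro comp_surj) auto
    then show "surj (blinfun_apply (F' z))" by (simp add: comp_def)
  next
    fix z assume z: "z \<in> U'" "F z = 0"
    define l where "l t = \<Psi> z0 + t *\<^sub>R (\<Psi> z - \<Psi> z0)" for t :: real
    have l_ball: "l t \<in> ball (\<Psi> z0) e" if "t \<in> {0..1}" for t
    proof -
      have "norm (t *\<^sub>R (\<Psi> z - \<Psi> z0)) \<le> 1 * norm (\<Psi> z - \<Psi> z0)"
        unfolding norm_scaleR using that by (intro mult_right_mono) auto
      also have "\<dots> < e" using z U' by (simp add: dist_norm norm_minus_commute)
      finally show ?thesis by (simp add: l_def dist_norm)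
    qed
    have l_der: "(l has_vector_derivative (\<Psi> z - \<Psi> z0)) (at t within {0..1})" for t
      unfolding l_def[abs_def] by (auto intro!: derivative_eq_intros)
    \<comment> \<open>\<open>F\<close> vanishes at both ends, so the segment keeps first component 0
      and its pullback consists of zeros.\<close>
    have "fst (l t) = 0" for t
      using z z0 by (simp add: l_def \<Psi>_def)
    then have F0: "F (g (l t)) = 0" if "t \<in> {0..1}" for t
      using gV(2)[of "l t"] l_ball[OF that] e(2) by (auto simp: \<Psi>_def prod_eq_iff)
    have "((\<lambda>t. g (l t)) has_vector_derivative g' (l t) (\<Psi> z - \<Psi> z0)) (at t within {0..1})"
      if "t \<in> {0..1}" for t
      using vector_derivative_diff_chain_within[OF l_der has_derivative_at_withinI[OF g]] l_ball[OF that] e(2)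
      by (auto simp: comp_def)
    moreover have "g (l 0) = z0" "g (l 1) = z"
      using gU z U' UV by (auto simp: l_def)
    moreover have "g (l t) \<in> U'" if "t \<in> {0..1}" for t
      using l_ball[OF that] by (simp add: U'_def)
    ultimately show "\<exists>\<gamma> \<gamma>'. \<gamma> 0 = z0 \<and> \<gamma> 1 = z \<and>
         (\<forall>t\<in>{0..1}. \<gamma> t \<in> U' \<and> F (\<gamma> t) = 0 \<and> (\<gamma> has_vector_derivative \<gamma>' t) (at t within {0..1}))"
      using F0 by (intro exI[of _ "\<lambda>t. g (l t)"] exI[of _ "\<lambda>t. g' (l t) (\<Psi> z - \<Psi> z0)"]) auto
  qed
qed

text \<open>A Lipschitz function that is constant along a curve tangent to \<open>\<gamma>\<close> at \<open>\<gamma> t\<close> has zero derivative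
  along \<open>\<gamma>\<close>, even where it is not differentiable itself.\<close>

lemma lipschitz_tangent_derivative_zero:
  fixes u :: "'a::real_normed_vector \<Rightarrow> real"
  assumes lip: "e > 0" "\<And>x x'. x \<in> ball (\<gamma> t) e \<Longrightarrow> x' \<in> ball (\<gamma> t) e \<Longrightarrow> \<bar>u x - u x'\<bar> \<le> C * norm (x - x')"
    and \<gamma>: "(\<gamma> has_vector_derivative v) (at t within S)"
    and \<beta>: "(\<beta> has_vector_derivative v) (at t)" "\<beta> t = \<gamma> t"
    and const: "\<forall>\<^sub>F s in at t. u (\<beta> s) = u (\<gamma> t)"
  shows "((\<lambda>s. u (\<gamma> s)) has_derivative (\<lambda>_. 0)) (at t within S)"
proof -
  have "((\<lambda>s. \<gamma> s - \<beta> s) has_vector_derivative v - v) (at t within S)"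
    by (intro has_vector_derivative_diff \<gamma> has_vector_derivative_at_within[OF \<beta>(1)])
  then have lim: "((\<lambda>s. norm (\<gamma> s - \<beta> s) / norm (s - t)) \<longlongrightarrow> 0) (at t within S)"
    using \<beta>(2) by (simp add: has_vector_derivative_def has_derivative_iff_norm)
  have "((\<lambda>s. norm (u (\<gamma> s) - u (\<gamma> t) - 0) / norm (s - t)) \<longlongrightarrow> 0) (at t within S)"
  proof (rule Lim_null_comparison)
    show "((\<lambda>s. \<bar>C\<bar> * (norm (\<gamma> s - \<beta> s) / norm (s - t))) \<longlongrightarrow> 0) (at t within S)"
      using tendsto_mult_left[OF lim, of "\<bar>C\<bar>"] by simp
    have lims: "(\<gamma> \<longlongrightarrow> \<gamma> t) (at t within S)" "(\<beta> \<longlongrightarrow> \<gamma> t) (at t within S)"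
      using has_vector_derivative_continuous[OF \<gamma>]
        has_vector_derivative_continuous[OF has_vector_derivative_at_within[OF \<beta>(1), of S]]
      unfolding continuous_within \<beta>(2) by blast+
    then have "\<forall>\<^sub>F s in at t within S. \<gamma> s \<in> ball (\<gamma> t) e" "\<forall>\<^sub>F s in at t within S. \<beta> s \<in> ball (\<gamma> t) e"
      using lip(1) topological_tendstoD[OF lims(1) open_ball[of "\<gamma> t" e]]
        topological_tendstoD[OF lims(2) open_ball[of "\<gamma> t" e]] by simp_all
    moreover have "\<forall>\<^sub>F s in at t within S. u (\<beta> s) = u (\<gamma> t)"
      by (rule filter_leD[OF at_le[OF subset_UNIV] const])
    ultimately show "\<forall>\<^sub>F s in at t within S. norm (norm (u (\<gamma> s) - u (\<gamma> t) - 0) / norm (s - t))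
        \<le> \<bar>C\<bar> * (norm (\<gamma> s - \<beta> s) / norm (s - t))"
    proof eventually_elim
      case (elim s)
      \<comment> \<open>Since \<open>u (\<gamma> t)\<close> equals \<open>u (\<beta> s)\<close>, the
        two curves are compared at the same time \<open>s\<close>, where their distance is of
        smaller order than \<open>s - t\<close>.\<close>
      have "\<bar>u (\<gamma> s) - u (\<gamma> t)\<bar> \<le> C * norm (\<gamma> s - \<beta> s)"
        using lip(2)[OF elim(1,2)] elim(3) by simp
      also have "\<dots> \<le> \<bar>C\<bar> * norm (\<gamma> s - \<beta> s)" by (intro mult_right_mono) auto
      finally show ?case by (simp add: divide_right_mono)
    qed
  qed
  then show ?thesis
    by (simp add: has_derivative_iff_norm)
qed

section \<open>Charts\<close>

text \<open>A Lebesgue number argument, applied to two coverings of the group: one makes Lipschitz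
  bounds uniform in the group element, the other a neighbourhood of a point. Monotonicity in
  \<open>e\<close> lets the least radius of a finite subcover serve everywhere.\<close>

lemma compact_space_uniform_radius:
  fixes P :: "real \<Rightarrow> 'a \<Rightarrow> bool"
  assumes "compact_space X"
    and local: "\<And>x. x \<in> topspace X \<Longrightarrow> \<exists>V e. openin X V \<and> x \<in> V \<and> e > 0 \<and> (\<forall>y\<in>V. P e y)"
    and mono: "\<And>y e e'. P e y \<Longrightarrow> 0 < e' \<Longrightarrow> e' \<le> e \<Longrightarrow> P e' y"
  obtains e where "e > 0" "\<And>y. y \<in> topspace X \<Longrightarrow> P e y"
proof -
  define \<U> where "\<U> = {V. openin X V \<and> (\<exists>e>0. \<forall>y\<in>V. P e y)}"
  have "topspace X \<subseteq> \<Union>\<U>"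
  proof
    fix x assume "x \<in> topspace X"
    from local[OF this] show "x \<in> \<Union>\<U>" by (auto simp: \<U>_def)
  qed
  moreover have "compactin X (topspace X)" using assms(1) by (simp add: compact_space_def)
  moreover have "openin X V" if "V \<in> \<U>" for V using that by (simp add: \<U>_def)
  ultimately have "\<exists>\<F>. finite \<F> \<and> \<F> \<subseteq> \<U> \<and> topspace X \<subseteq> \<Union>\<F>" using compactinD by metis
  then obtain \<F> where \<F>: "finite \<F>" "\<F> \<subseteq> \<U>" "topspace X \<subseteq> \<Union>\<F>" by blast
  then have "\<forall>V\<in>\<F>. \<exists>e>0. \<forall>y\<in>V. P e y" by (auto simp: \<U>_def)
  then obtain e where e: "\<forall>V\<in>\<F>. e V > 0 \<and> (\<forall>y\<in>V. P (e V) y)"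
    using bchoice[of \<F> "\<lambda>V e. e > 0 \<and> (\<forall>y\<in>V. P e y)"] by blast
  \<comment> \<open>The extra 1 keeps the set under \<open>Min\<close> nonempty when the subcover is
    empty.\<close>
  define r where "r = Min (insert 1 (e ` \<F>))"
  show thesis
  proof
    show "r > 0" using \<F>(1) e by (simp add: r_def)
    fix y assume "y \<in> topspace X"
    then obtain V where V: "V \<in> \<F>" "y \<in> V" using \<F>(3) by blast
    then have "r \<le> e V" "P (e V) y" using \<F>(1) e by (simp_all add: r_def)
    then show "P r y" using \<open>r > 0\<close> mono by blast
  qed
qed

lemma chart_domain:
  assumes "smooth_manifold M" "c \<in> charts M"
  shows "openin (mtop M) (cdom c)" "cdom c \<subseteq> points M" "open (cmap c ` cdom c)" "inj_on (cmap c) (cdom c)"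
    "homeomorphic_map (subtopology (mtop M) (cdom c)) (top_of_set (cmap c ` cdom c)) (cmap c)"
proof -
  show *: "openin (mtop M) (cdom c)" "open (cmap c ` cdom c)"
    "homeomorphic_map (subtopology (mtop M) (cdom c)) (top_of_set (cmap c ` cdom c)) (cmap c)"
    using assms by (auto simp: smooth_manifold_def)
  show sub: "cdom c \<subseteq> points M" using *(1) by (rule openin_subset)
  show "inj_on (cmap c) (cdom c)"
    using homeomorphic_imp_injective_map[OF *(3)] sub by (simp add: Int_absorb1)
qed

lemma cinv_cmap:
  assumes "smooth_manifold M" "c \<in> charts M" "p \<in> cdom c"
  shows "cinv c (cmap c p) = p"
  using chart_domain(4)[OF assms(1,2)] assms(3) by (simp add: cinv_def)

lemma chart_inverse:
  assumes "x \<in> cmap c ` cdom c"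
  shows "cinv c x \<in> cdom c" "cmap c (cinv c x) = x"
  using assms by (simp_all add: cinv_def inv_into_into f_inv_into_f)

lemma open_chart_image:
  assumes M: "smooth_manifold M" "c \<in> charts M" and U: "openin (mtop M) U" "U \<subseteq> cdom c"
  shows "open (cmap c ` U)"
proof -
  have "openin (subtopology (mtop M) (cdom c)) U"
    using U by (auto simp: openin_subtopology)
  then have "openin (top_of_set (cmap c ` cdom c)) (cmap c ` U)"
    using homeomorphic_imp_open_map[OF chart_domain(5)[OF M]] by (simp add: open_map_def)
  then show ?thesis
    using chart_domain(3)[OF M] openin_open_trans by blast
qed

lemma openin_chart_vimage:
  assumes M: "smooth_manifold M" "c \<in> charts M" and S: "open S"
  shows "openin (mtop M) {p \<in> cdom c. cmap c p \<in> S}"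
proof -
  have "continuous_map (subtopology (mtop M) (cdom c)) (top_of_set (cmap c ` cdom c)) (cmap c)"
    using chart_domain(5)[OF M] homeomorphic_imp_continuous_map by blast
  then have "continuous_map (subtopology (mtop M) (cdom c)) euclidean (cmap c)"
    using continuous_map_into_fulltopology by blast
  then have "openin (subtopology (mtop M) (cdom c)) {p \<in> topspace (subtopology (mtop M) (cdom c)). cmap c p \<in> S}"
    using S by (intro openin_continuous_map_preimage) auto
  moreover have "topspace (subtopology (mtop M) (cdom c)) = cdom c"
    using chart_domain(2)[OF M] by auto
  ultimately show ?thesis
    using chart_domain(1)[OF M] openin_trans_full by metis
qed

lemma charts_at_nonempty:
  assumes "smooth_manifold M" "p \<in> points M"
  obtains c where "c \<in> charts_at M p"
  using assms unfolding smooth_manifold_def charts_at_def by blast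

lemma chart_around:
  assumes "smooth_manifold M" "p \<in> points M"
  obtains c where "c \<in> charts M" "p \<in> cdom c"
  using assms unfolding smooth_manifold_def by blast

lemma charts_atD: "c \<in> charts_at M p \<Longrightarrow> c \<in> charts M" "c \<in> charts_at M p \<Longrightarrow> p \<in> cdom c"
  by (simp_all add: charts_at_def)

lemma chart_ball:
  assumes M: "smooth_manifold M" "c \<in> charts M" and U: "openin (mtop M) U" "p \<in> U" "p \<in> cdom c"
  obtains e where "e > 0" "ball (cmap c p) e \<subseteq> cmap c ` cdom c"
    "\<And>x. x \<in> ball (cmap c p) e \<Longrightarrow> cinv c x \<in> U"
proof -
  have "open (cmap c ` (U \<inter> cdom c))"
    using U chart_domain(1)[OF M] by (intro open_chart_image[OF M]) auto
  then obtain e where e: "e > 0" "ball (cmap c p) e \<subseteq> cmap c ` (U \<inter> cdom c)"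
    using U openE by (metis IntI image_eqI)
  show thesis
  proof
    show "e > 0" "ball (cmap c p) e \<subseteq> cmap c ` cdom c" using e by auto
    fix x assume "x \<in> ball (cmap c p) e"
    then show "cinv c x \<in> U" using e cinv_cmap[OF M] by auto
  qed
qed

text \<open>Makes a closed ball in a chart compact, hence closed, in the Hausdorff manifold itself
  and not just in the chart domain, so that a bump can be extended by zero without trouble at the
  chart boundary.\<close>

lemma compactin_chart_preimage:
  assumes M: "smooth_manifold M" "c \<in> charts M" and K: "compact K" "K \<subseteq> cmap c ` cdom c"
  shows "compactin (mtop M) {p \<in> cdom c. cmap c p \<in> K}"
proof -
  obtain g where g: "homeomorphic_maps (subtopology (mtop M) (cdom c)) (top_of_set (cmap c ` cdom c)) (cmap c) g"
    using chart_domain(5)[OF M] homeomorphic_map_maps by blast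
  then have cont: "continuous_map (top_of_set (cmap c ` cdom c)) (subtopology (mtop M) (cdom c)) g"
    and g_inv: "\<And>p. p \<in> cdom c \<Longrightarrow> g (cmap c p) = p"
    using chart_domain(2)[OF M] by (auto simp: homeomorphic_maps_def)
  have "compactin (top_of_set (cmap c ` cdom c)) K"
    using K by (simp add: compactin_subtopology)
  then have "compactin (subtopology (mtop M) (cdom c)) (g ` K)"
    using cont image_compactin by blast
  moreover have "g ` K = {p \<in> cdom c. cmap c p \<in> K}"
    using K(2) g_inv by (auto simp: image_iff) (metis imageE subsetD)+
  ultimately show ?thesis
    by (simp add: compactin_subtopology)
qed

section \<open>Product charts\<close>

abbreviation prod_chart :: "('a, 'e) chart \<Rightarrow> ('b, 'f) chart \<Rightarrow> ('a \<times> 'b, 'e \<times> 'f) chart" where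
  "prod_chart c d \<equiv> (cdom c \<times> cdom d, map_prod (cmap c) (cmap d))"

lemma prod_chart_in_charts:
  "c \<in> charts M \<Longrightarrow> d \<in> charts M' \<Longrightarrow> prod_chart c d \<in> charts (product_manifold M M')"
  by (simp add: product_manifold_def del: split_paired_Ex) blast

lemma charts_at_product:
  "charts_at (product_manifold M M') (p, q) = {prod_chart c d | c d. c \<in> charts_at M p \<and> d \<in> charts_at M' q}"
proof (intro equalityI subsetI)
  fix k assume "k \<in> charts_at (product_manifold M M') (p, q)"
  then have "(p, q) \<in> cdom k" "k \<in> charts (product_manifold M M')"
    by (simp_all add: charts_at_def)
  moreover from this(2) obtain c d where "c \<in> charts M" "d \<in> charts M'" "k = prod_chart c d"
    unfolding product_manifold_def manifold.simps mem_Collect_eq by (elim exE conjE) (rule that)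
  ultimately show "k \<in> {prod_chart c d | c d. c \<in> charts_at M p \<and> d \<in> charts_at M' q}"
    by (simp add: charts_at_def del: split_paired_Ex) blast
next
  fix k assume "k \<in> {prod_chart c d | c d. c \<in> charts_at M p \<and> d \<in> charts_at M' q}"
  then obtain c d where cd: "c \<in> charts_at M p" "d \<in> charts_at M' q" "k = prod_chart c d"
    unfolding mem_Collect_eq by (elim exE conjE) (rule that)
  then show "k \<in> charts_at (product_manifold M M') (p, q)"
    using prod_chart_in_charts[of c M d M'] by (simp add: charts_at_def)
qed

lemma cinv_prod_chart:
  assumes "smooth_manifold M" "c \<in> charts M" "smooth_manifold M'" "d \<in> charts M'"
    and "x \<in> cmap c ` cdom c" "y \<in> cmap d ` cdom d"
  shows "cinv (prod_chart c d) (x, y) = (cinv c x, cinv d y)"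
proof -
  have "inj_on (map_prod (cmap c) (cmap d)) (cdom c \<times> cdom d)"
    using chart_domain(4)[OF assms(1,2)] chart_domain(4)[OF assms(3,4)] by (rule map_prod_inj_on)
  then have "inv_into (cdom c \<times> cdom d) (map_prod (cmap c) (cmap d))
      (map_prod (cmap c) (cmap d) (cinv c x, cinv d y)) = (cinv c x, cinv d y)"
    using chart_inverse[OF assms(5)] chart_inverse[OF assms(6)] by (intro inv_into_f_f) auto
  then show ?thesis
    using chart_inverse[OF assms(5)] chart_inverse[OF assms(6)] by (simp add: cinv_def[of "prod_chart c d"])
qed

lemma open_prod_chart_image:
  assumes M: "smooth_manifold M" "c \<in> charts M" and M': "smooth_manifold M'" "d \<in> charts M'"
    and W: "openin (prod_topology (mtop M) (mtop M')) W" "W \<subseteq> cdom c \<times> cdom d"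
  shows "open (map_prod (cmap c) (cmap d) ` W)"
proof (subst open_subopen, intro ballI)
  fix z assume "z \<in> map_prod (cmap c) (cmap d) ` W"
  then obtain p g where pg: "(p, g) \<in> W" "z = (cmap c p, cmap d g)" by auto
  then obtain U V where UV: "openin (mtop M) U" "openin (mtop M') V" "p \<in> U" "g \<in> V" "U \<times> V \<subseteq> W"
    using W(1)[unfolded openin_prod_topology_alt, rule_format, OF pg(1)] by (elim exE conjE) (rule that)
  then have "U \<times> V \<subseteq> cdom c \<times> cdom d" using W(2) by (meson subset_trans)
  then have "U \<subseteq> cdom c" "V \<subseteq> cdom d" using UV(3,4) by (auto simp: times_subset_iff)
  with UV have "open ((cmap c ` U) \<times> (cmap d ` V))"
    using UV open_chart_image[OF M] open_chart_image[OF M'] by (intro open_Times) auto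
  moreover have "z \<in> (cmap c ` U) \<times> (cmap d ` V)" using UV pg by auto
  moreover have "(cmap c ` U) \<times> (cmap d ` V) \<subseteq> map_prod (cmap c) (cmap d) ` W"
  proof clarify
    fix p g assume "p \<in> U" "g \<in> V"
    then have "(p, g) \<in> W" using UV(5) by blast
    then show "(cmap c p, cmap d g) \<in> map_prod (cmap c) (cmap d) ` W"
      using image_eqI[of "(cmap c p, cmap d g)" "map_prod (cmap c) (cmap d)" "(p, g)" W] by simp
  qed
  ultimately show "\<exists>T. open T \<and> z \<in> T \<and> T \<subseteq> map_prod (cmap c) (cmap d) ` W" by blast
qed


section \<open>Invariant functions of compact actions\<close>

text \<open>Lipschitz functions are used because a supremum over an orbit preserves a common
  Lipschitz bound, whereas it may destroy differentiability. The bounds are taken in coordinates, so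
  no distance on the manifold is involved.\<close>

definition locally_lipschitz :: "('a, 'e::euclidean_space) manifold \<Rightarrow> ('a \<Rightarrow> real) \<Rightarrow> bool" where
  "locally_lipschitz M u \<longleftrightarrow>
     (\<forall>c\<in>charts M. \<forall>p\<in>cdom c. \<exists>e>0. \<exists>C. \<forall>x\<in>ball (cmap c p) e. \<forall>x'\<in>ball (cmap c p) e.
        \<bar>u (cinv c x) - u (cinv c x')\<bar> \<le> C * norm (x - x'))"

text \<open>The points of \<open>\<G>\<close> are the transformations themselves. The group laws are
  stated as identities at points of \<open>N\<close>, which is all that orbits can see, so maps are
  never compared off the manifold.\<close>

locale compact_abelian_action =
  fixes N :: "('a, 'e::euclidean_space) manifold" and \<G> :: "('a \<Rightarrow> 'a, 'h::euclidean_space) manifold"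
  assumes N: "smooth_manifold N" and \<G>: "smooth_manifold \<G>" and compact_\<G>: "compact_space (mtop \<G>)"
    and action: "smooth_map (product_manifold N \<G>) N (\<lambda>(p, g). g p)"
    and element: "g \<in> points \<G> \<Longrightarrow> smooth_map N N g"
    and one: "\<exists>e\<in>points \<G>. \<forall>p\<in>points N. e p = p"
    and mult: "g \<in> points \<G> \<Longrightarrow> h \<in> points \<G> \<Longrightarrow> \<exists>k\<in>points \<G>. \<forall>p\<in>points N. k p = g (h p)"
    and inverse: "g \<in> points \<G> \<Longrightarrow> \<exists>k\<in>points \<G>. \<forall>p\<in>points N. k (g p) = p"
    and commute: "g \<in> points \<G> \<Longrightarrow> h \<in> points \<G> \<Longrightarrow> p \<in> points N \<Longrightarrow> g (h p) = h (g p)"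
begin

definition orbit :: "'a \<Rightarrow> 'a set" where
  "orbit p = (\<lambda>g. g p) ` points \<G>"

definition act_rep :: "('a, 'e) chart \<Rightarrow> ('a \<Rightarrow> 'a, 'h) chart \<Rightarrow> ('a, 'e) chart \<Rightarrow> 'e \<times> 'h \<Rightarrow> 'e" where
  "act_rep c d c' = cmap c' \<circ> (\<lambda>(p, g). g p) \<circ> cinv (prod_chart c d)"

definition act_dom :: "('a, 'e) chart \<Rightarrow> ('a \<Rightarrow> 'a, 'h) chart \<Rightarrow> ('a, 'e) chart \<Rightarrow> ('e \<times> 'h) set" where
  "act_dom c d c' = map_prod (cmap c) (cmap d) ` {z \<in> cdom c \<times> cdom d. (snd z) (fst z) \<in> cdom c'}"

lemma continuous_action: "continuous_map (prod_topology (mtop N) (mtop \<G>)) (mtop N) (\<lambda>(p, g). g p)"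
  using action by (simp add: smooth_map_def product_manifold_def)

lemma action_points: "g \<in> points \<G> \<Longrightarrow> p \<in> points N \<Longrightarrow> g p \<in> points N"
  using continuous_action by (fastforce simp: continuous_map_def Pi_iff)

lemma continuous_element: "g \<in> points \<G> \<Longrightarrow> continuous_map (mtop N) (mtop N) g"
  using element by (simp add: smooth_map_def)

lemma smooth_act_rep:
  assumes "c \<in> charts N" "d \<in> charts \<G>" "c' \<in> charts N"
  shows "smooth_on (act_dom c d c') (act_rep c d c')"
proof -
  have "smooth_on (cmap (prod_chart c d) ` {p \<in> cdom (prod_chart c d). (\<lambda>(p, g). g p) p \<in> cdom c'})
      (cmap c' \<circ> (\<lambda>(p, g). g p) \<circ> cinv (prod_chart c d))"
    using action assms prod_chart_in_charts[OF assms(1,2)] unfolding smooth_map_def by blast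
  then show ?thesis
    by (simp add: act_rep_def act_dom_def case_prod_beta)
qed

lemma open_act_dom:
  assumes "c \<in> charts N" "d \<in> charts \<G>" "c' \<in> charts N"
  shows "open (act_dom c d c')"
  unfolding act_dom_def
proof (rule open_prod_chart_image[OF N assms(1) \<G> assms(2)])
  have "openin (prod_topology (mtop N) (mtop \<G>))
     ((cdom c \<times> cdom d) \<inter> {z \<in> topspace (prod_topology (mtop N) (mtop \<G>)). (\<lambda>(p, g). g p) z \<in> cdom c'})"
    using chart_domain(1)[OF N] chart_domain(1)[OF \<G>] assms
    by (intro openin_Int openin_continuous_map_preimage[OF continuous_action])
       (simp_all add: openin_prod_Times_iff)
  moreover have "{z \<in> cdom c \<times> cdom d. (snd z) (fst z) \<in> cdom c'} =
     (cdom c \<times> cdom d) \<inter> {z \<in> topspace (prod_topology (mtop N) (mtop \<G>)). (\<lambda>(p, g). g p) z \<in> cdom c'}"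
    using chart_domain(2)[OF N assms(1)] chart_domain(2)[OF \<G> assms(2)] by auto
  ultimately show "openin (prod_topology (mtop N) (mtop \<G>)) {z \<in> cdom c \<times> cdom d. (snd z) (fst z) \<in> cdom c'}"
    by simp
qed auto

lemma act_domI:
  "p \<in> cdom c \<Longrightarrow> g \<in> cdom d \<Longrightarrow> g p \<in> cdom c' \<Longrightarrow> (cmap c p, cmap d g) \<in> act_dom c d c'"
  unfolding act_dom_def by force

lemma act_domE:
  assumes "c \<in> charts N" "d \<in> charts \<G>" "(x, y) \<in> act_dom c d c'"
  shows "x \<in> cmap c ` cdom c" "y \<in> cmap d ` cdom d" "cinv d y (cinv c x) \<in> cdom c'"
  using assms(3) cinv_cmap[OF N assms(1)] cinv_cmap[OF \<G> assms(2)] unfolding act_dom_def by auto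

lemma act_rep_eq:
  assumes "c \<in> charts N" "d \<in> charts \<G>" "(x, y) \<in> act_dom c d c'"
  shows "act_rep c d c' (x, y) = cmap c' (cinv d y (cinv c x))"
  using cinv_prod_chart[OF N assms(1) \<G> assms(2) act_domE(1,2)[OF assms]] by (simp add: act_rep_def)

lemma orbit_self: "p \<in> points N \<Longrightarrow> p \<in> orbit p"
  using one unfolding orbit_def by (metis image_eqI)

lemma orbit_action:
  assumes "g \<in> points \<G>" "p \<in> points N"
  shows "orbit (g p) = orbit p"
proof
  show "orbit (g p) \<subseteq> orbit p"
  proof
    fix q assume "q \<in> orbit (g p)"
    then obtain h where h: "h \<in> points \<G>" "q = h (g p)" unfolding orbit_def by blast
    obtain k where "k \<in> points \<G>" "\<forall>q\<in>points N. k q = h (g q)" using mult[OF h(1) assms(1)] by blast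
    then show "q \<in> orbit p"
      using h assms(2) unfolding orbit_def by (metis image_eqI)
  qed
  obtain k where k: "k \<in> points \<G>" "k (g p) = p"
    using inverse[OF assms(1)] assms(2) by blast
  show "orbit p \<subseteq> orbit (g p)"
  proof
    fix q assume "q \<in> orbit p"
    then obtain h where h: "h \<in> points \<G>" "q = h p" unfolding orbit_def by blast
    obtain l where "l \<in> points \<G>" "\<forall>q\<in>points N. l q = h (k q)" using mult[OF h(1) k(1)] by blast
    then show "q \<in> orbit (g p)"
      using h k action_points[OF assms] unfolding orbit_def by (metis image_eqI)
  qed
qed

lemma closedin_orbit:
  assumes "p \<in> points N"
  shows "closedin (mtop N) (orbit p)"
proof -
  have "continuous_map (mtop \<G>) (prod_topology (mtop N) (mtop \<G>)) (\<lambda>g. (p, g))"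
    using assms by (simp add: continuous_map_pairedI)
  then have "continuous_map (mtop \<G>) (mtop N) ((\<lambda>(p, g). g p) \<circ> (\<lambda>g. (p, g)))"
    using continuous_action continuous_map_compose by blast
  then have "continuous_map (mtop \<G>) (mtop N) (\<lambda>g. g p)"
    by (simp add: comp_def)
  then have "compactin (mtop N) (orbit p)"
    using compact_\<G> image_compactin unfolding orbit_def compact_space_def by blast
  then show ?thesis
    using N compactin_imp_closedin by (auto simp: smooth_manifold_def)
qed

text \<open>Averaging is not needed: the supremum of a bump function over an orbit is invariant and, because
  the group is compact, inherits the local Lipschitz bounds of the bump.\<close>

lemma orbit_separation:
  assumes p0: "p0 \<in> points N" and q: "q \<in> points N" "q \<notin> orbit p0"
  obtains u where "\<And>g p. g \<in> points \<G> \<Longrightarrow> p \<in> points N \<Longrightarrow> u (g p) = u p"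
    "locally_lipschitz N u" "u p0 \<noteq> u q"
proof -
  obtain c1 where c1: "c1 \<in> charts N" "q \<in> cdom c1"
    using chart_around[OF N q(1)] by metis
  have "openin (mtop N) (cdom c1 - orbit p0)"
    using chart_domain(1)[OF N c1(1)] closedin_orbit[OF p0] by (rule openin_diff)
  then have "open (cmap c1 ` (cdom c1 - orbit p0))"
    by (rule open_chart_image[OF N c1(1)]) auto
  then obtain \<epsilon> where \<epsilon>: "\<epsilon> > 0" "cball (cmap c1 q) \<epsilon> \<subseteq> cmap c1 ` (cdom c1 - orbit p0)"
    using c1 q(2) by (metis DiffI image_eqI open_contains_cball)
  \<comment> \<open>A tent of height \<epsilon>: it is 1-Lipschitz, positive at the coordinates of
    \<open>q\<close>, and vanishes outside the closed ball, so \<open>w\<close> is supported in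
    \<open>K\<close>, away from the orbit of \<open>p0\<close>.\<close>
  define \<beta> where "\<beta> x = max 0 (\<epsilon> - dist x (cmap c1 q))" for x
  define w where "w z = (if z \<in> cdom c1 then \<beta> (cmap c1 z) else 0)" for z
  define K where "K = {z \<in> cdom c1. cmap c1 z \<in> cball (cmap c1 q) \<epsilon>}"
  have closedK: "closedin (mtop N) K"
    unfolding K_def using \<epsilon>(2) N
    by (intro compactin_imp_closedin compactin_chart_preimage[OF N c1(1)]) (auto simp: smooth_manifold_def)
  have w0: "w z = 0" if "z \<notin> K" for z
    using that by (auto simp: w_def K_def \<beta>_def dist_commute)
  have w_bounds: "0 \<le> w z" "w z \<le> \<epsilon>" for z
    using \<epsilon>(1) by (auto simp: w_def \<beta>_def)
  have \<beta>_lip: "\<bar>\<beta> x - \<beta> x'\<bar> \<le> norm (x - x')" for x x'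
    using dist_triangle2[of x "cmap c1 q" x'] dist_triangle2[of x' "cmap c1 q" x]
    unfolding \<beta>_def by (simp add: dist_norm norm_minus_commute)
  have K_orbit: "z \<notin> orbit p0" if "z \<in> K" for z
  proof -
    obtain z' where "z' \<in> cdom c1 - orbit p0" "cmap c1 z = cmap c1 z'"
      using \<epsilon>(2) \<open>z \<in> K\<close> unfolding K_def by blast
    then show ?thesis
      using chart_domain(4)[OF N c1(1)] \<open>z \<in> K\<close> unfolding K_def inj_on_def by blast
  qed
  define u where "u p = (SUP g\<in>points \<G>. w (g p))" for p
  have bdd: "bdd_above ((\<lambda>g. w (g p)) ` points \<G>)" for p
    using w_bounds by (auto simp: bdd_above_def)
  have ne: "points \<G> \<noteq> {}" using one by auto
  show thesis
  proof
    fix g p assume g: "g \<in> points \<G>" "p \<in> points N"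
    have "w ` orbit (g p) = w ` orbit p" using orbit_action[OF g] by simp
    then have "(\<lambda>k. w (k (g p))) ` points \<G> = (\<lambda>k. w (k p)) ` points \<G>"
      by (simp add: orbit_def image_image)
    then show "u (g p) = u p" by (simp add: u_def)
  next
    have "w (g p0) = 0" if "g \<in> points \<G>" for g
      using w0[of "g p0"] K_orbit[of "g p0"] that by (auto simp: orbit_def)
    then have "(\<lambda>g. w (g p0)) ` points \<G> = {0}"
      using ne by (simp add: image_constant_conv)
    then have "u p0 = 0" by (simp add: u_def)
    moreover have "u q \<ge> w q"
    proof -
      obtain e where "e \<in> points \<G>" "e q = q" using one q(1) by blast
      then show ?thesis unfolding u_def using cSUP_upper[OF _ bdd] by metis
    qed
    moreover have "w q > 0" using c1 \<epsilon> by (simp add: w_def \<beta>_def)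
    ultimately show "u p0 \<noteq> u q" by simp
  next
    show "locally_lipschitz N u"
      unfolding locally_lipschitz_def
    proof (intro ballI)
      fix c p assume c: "c \<in> charts N" "p \<in> cdom c"
      \<comment> \<open>One number \<open>e\<close> is both the radius of the ball and the
        reciprocal of the Lipschitz constant. Shrinking \<open>e\<close> weakens the claim, as
        \<open>compact_space_uniform_radius\<close> requires.\<close>
      let ?P = "\<lambda>e h. \<forall>x\<in>ball (cmap c p) e. \<forall>x'\<in>ball (cmap c p) e.
          \<bar>w (h (cinv c x)) - w (h (cinv c x'))\<bar> \<le> inverse e * norm (x - x')"
      have local: "\<exists>V e. openin (mtop \<G>) V \<and> h \<in> V \<and> e > 0 \<and> (\<forall>h'\<in>V. ?P e h')" if h: "h \<in> points \<G>" for h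
      \<comment> \<open>If \<open>h p\<close> lies in the chart of the bump, \<open>w\<close> near
        it is the tent composed with the smooth action, Lipschitz jointly in the point and the group
        element. Otherwise \<open>h p\<close> is off the closed set \<open>K\<close>, and
        \<open>w\<close> vanishes at the images of all nearby points under all nearby
        elements.\<close>
      proof (cases "h p \<in> cdom c1")
        case True
        obtain d where d: "d \<in> charts \<G>" "h \<in> cdom d"
          using chart_around[OF \<G> h] by metis
        obtain e C where e: "e > 0" "C > 0" "ball (cmap c p, cmap d h) e \<subseteq> act_dom c d c1"
          and lip: "\<And>z z'. z \<in> ball (cmap c p, cmap d h) e \<Longrightarrow> z' \<in> ball (cmap c p, cmap d h) e
            \<Longrightarrow> norm (act_rep c d c1 z - act_rep c d c1 z') \<le> C * norm (z - z')"
          using smooth_on_local_lipschitz[OF smooth_act_rep[OF c(1) d(1) c1(1)] open_act_dom[OF c(1) d(1) c1(1)]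
              act_domI[OF c(2) d(2) True]] by metis
        \<comment> \<open>\<open>e / 2\<close> leaves room for the group coordinate within the
          product ball; \<open>inverse C\<close> turns the constant \<open>C\<close> into the bound
          \<open>inverse r\<close>.\<close>
        define r where "r = min (e / 2) (inverse C)"
        define V where "V = {h' \<in> cdom d. cmap d h' \<in> ball (cmap d h) (e / 2)}"
        have "?P r h'" if "h' \<in> V" for h'
        proof (intro ballI)
          fix x x' assume x: "x \<in> ball (cmap c p) r" "x' \<in> ball (cmap c p) r"
          have inb: "(y, cmap d h') \<in> ball (cmap c p, cmap d h) e" if "y \<in> ball (cmap c p) r" for y
          proof -
            have "norm (cmap c p - y, cmap d h - cmap d h') \<le> norm (cmap c p - y) + norm (cmap d h - cmap d h')"
              by (rule norm_Pair_le)
            also have "\<dots> < e / 2 + e / 2"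
              using that \<open>h' \<in> V\<close> by (intro add_strict_mono) (auto simp: V_def r_def dist_norm)
            finally show ?thesis by (simp add: dist_norm)
          qed
          have wrep: "w (h' (cinv c y)) = \<beta> (act_rep c d c1 (y, cmap d h'))" if "y \<in> ball (cmap c p) r" for y
          proof -
            have dom: "(y, cmap d h') \<in> act_dom c d c1" using inb[OF that] e(3) by blast
            have "cinv d (cmap d h') = h'" using cinv_cmap[OF \<G> d(1)] \<open>h' \<in> V\<close> by (simp add: V_def)
            then show ?thesis
              using act_rep_eq[OF c(1) d(1) dom] act_domE(3)[OF c(1) d(1) dom] by (simp add: w_def)
          qed
          have "\<bar>w (h' (cinv c x)) - w (h' (cinv c x'))\<bar>
              \<le> norm (act_rep c d c1 (x, cmap d h') - act_rep c d c1 (x', cmap d h'))"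
            using \<beta>_lip x by (simp add: wrep)
          also have "\<dots> \<le> C * norm ((x, cmap d h') - (x', cmap d h'))"
            using x by (intro lip inb)
          also have "\<dots> = C * norm (x - x')" by (simp add: norm_Pair)
          also have "\<dots> \<le> inverse r * norm (x - x')"
          proof (rule mult_right_mono)
            have "inverse (inverse C) \<le> inverse r"
              using e by (intro le_imp_inverse_le) (auto simp: r_def)
            then show "C \<le> inverse r" by simp
          qed simp
          finally show "\<bar>w (h' (cinv c x)) - w (h' (cinv c x'))\<bar> \<le> inverse r * norm (x - x')" .
        qed
        moreover have "openin (mtop \<G>) V"
          unfolding V_def by (intro openin_chart_vimage[OF \<G> d(1)]) simp
        moreover have "h \<in> V" "r > 0" using d e by (auto simp: V_def r_def)
        ultimately show ?thesis by blast
      next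
        case False
        let ?W = "{z \<in> topspace (prod_topology (mtop N) (mtop \<G>)). (\<lambda>(p, g). g p) z \<in> points N - K}"
        have "openin (prod_topology (mtop N) (mtop \<G>)) ?W"
          using closedK by (intro openin_continuous_map_preimage[OF continuous_action]) auto
        moreover have "(p, h) \<in> ?W"
          using False h c chart_domain(2)[OF N c(1)] action_points by (auto simp: K_def)
        ultimately have "\<exists>U V. openin (mtop N) U \<and> openin (mtop \<G>) V \<and> p \<in> U \<and> h \<in> V \<and> U \<times> V \<subseteq> ?W"
          by (rule openin_prod_topology_alt[THEN iffD1, rule_format])
        then obtain U V where UV': "openin (mtop N) U \<and> openin (mtop \<G>) V \<and> p \<in> U \<and> h \<in> V \<and> U \<times> V \<subseteq> ?W"
          by (elim exE)
        then have UV: "openin (mtop N) U" "openin (mtop \<G>) V" "p \<in> U" "h \<in> V" "U \<times> V \<subseteq> ?W"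
          by (simp_all only:)
        obtain e where e: "e > 0" "\<And>x. x \<in> ball (cmap c p) e \<Longrightarrow> cinv c x \<in> U"
          by (rule chart_ball[OF N c(1) UV(1,3) c(2)]) (rule that)
        have "w (h' (cinv c x)) = 0" if "h' \<in> V" "x \<in> ball (cmap c p) e" for h' x
          using UV(5) that e(2)[OF that(2)] by (intro w0) auto
        then have "?P e h'" if "h' \<in> V" for h' using that e(1) by auto
        then show ?thesis using UV e(1) by blast
      qed
      obtain e where e: "e > 0" "\<And>h. h \<in> points \<G> \<Longrightarrow> ?P e h"
      proof (rule compact_space_uniform_radius[OF compact_\<G>, of ?P])
        show "\<exists>V e. openin (mtop \<G>) V \<and> h \<in> V \<and> e > 0 \<and> (\<forall>h'\<in>V. ?P e h')" if "h \<in> points \<G>" for h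
          using local[OF that] .
        show "?P e' h" if P: "?P e h" "0 < e'" "e' \<le> e" for h e e'
        proof (intro ballI)
          fix x x' assume "x \<in> ball (cmap c p) e'" "x' \<in> ball (cmap c p) e'"
          then have "\<bar>w (h (cinv c x)) - w (h (cinv c x'))\<bar> \<le> inverse e * norm (x - x')"
            using P by auto
          also have "\<dots> \<le> inverse e' * norm (x - x')"
            using P by (intro mult_right_mono le_imp_inverse_le) auto
          finally show "\<bar>w (h (cinv c x)) - w (h (cinv c x'))\<bar> \<le> inverse e' * norm (x - x')" .
        qed
      qed (rule that)
      \<comment> \<open>Each term of the supremum at one point is bounded by the term of the same
        \<open>h\<close> at the other point plus a common error, so the bound survives the supremum;
        exchanging the points gives the absolute value.\<close>
      have half: "u (cinv c x) \<le> u (cinv c x') + inverse e * norm (x - x')"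
        if x: "x \<in> ball (cmap c p) e" "x' \<in> ball (cmap c p) e" for x x'
        unfolding u_def[of "cinv c x"]
      proof (rule cSUP_least[OF ne])
        fix h assume h: "h \<in> points \<G>"
        have "w (h (cinv c x')) \<le> u (cinv c x')"
          unfolding u_def using h by (rule cSUP_upper[OF _ bdd])
        moreover have "\<bar>w (h (cinv c x)) - w (h (cinv c x'))\<bar> \<le> inverse e * norm (x - x')"
          using e(2)[OF h] x by blast
        ultimately show "w (h (cinv c x)) \<le> u (cinv c x') + inverse e * norm (x - x')"
          by linarith
      qed
      have "\<bar>u (cinv c x) - u (cinv c x')\<bar> \<le> inverse e * norm (x - x')"
        if x: "x \<in> ball (cmap c p) e" "x' \<in> ball (cmap c p) e" for x x'
        using half[OF x] half[OF x(2) x(1)] by (simp add: norm_minus_commute abs_le_iff)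
      then show "\<exists>e>0. \<exists>C. \<forall>x\<in>ball (cmap c p) e. \<forall>x'\<in>ball (cmap c p) e.
          \<bar>u (cinv c x) - u (cinv c x')\<bar> \<le> C * norm (x - x')"
        using e(1) by blast
    qed
  qed
qed

end

section \<open>Maps commuting with a flow\<close>

lemma continuous_curve_nhds:
  assumes "continuous_map euclideanreal X \<alpha>" "openin X U" "\<alpha> t \<in> U"
  obtains \<delta> where "\<delta> > 0" "\<And>s. s \<in> ball t \<delta> \<Longrightarrow> \<alpha> s \<in> U"
proof -
  have "open {s. \<alpha> s \<in> U}"
    using openin_continuous_map_preimage[OF assms(1,2)] by simp
  then obtain \<delta> where "\<delta> > 0" "ball t \<delta> \<subseteq> {s. \<alpha> s \<in> U}"
    using assms(3) by (metis mem_Collect_eq openE)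
  then show thesis using that by blast
qed

section \<open>Uniqueness of integral curves\<close>

definition integral_curve :: "('a, 'e::euclidean_space) manifold \<Rightarrow> ('a \<Rightarrow> ('a, 'e) tvec) \<Rightarrow> (real \<Rightarrow> 'a) \<Rightarrow> bool"
  where
  "integral_curve M T \<alpha> \<longleftrightarrow> continuous_map euclideanreal (mtop M) \<alpha> \<and>
     (\<forall>t. \<forall>c\<in>charts_at M (\<alpha> t). ((\<lambda>s. cmap c (\<alpha> s)) has_vector_derivative T (\<alpha> t) c) (at t))"

text \<open>On a time interval short against the Lipschitz constant of the field, the difference of
  the curves in a chart has a maximal norm that is at most half of itself. This takes the place of
  Gronwall's inequality.\<close>

lemma integral_curves_locally_equal:
  assumes M: "smooth_manifold M" and T: "smooth_vector_field M T"
    and \<alpha>: "integral_curve M T \<alpha>" and \<beta>: "integral_curve M T \<beta>" and eq: "\<alpha> t0 = \<beta> t0"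
  obtains \<delta> where "\<delta> > 0" "\<And>t. t \<in> ball t0 \<delta> \<Longrightarrow> \<alpha> t = \<beta> t"
proof -
  have cont: "continuous_map euclideanreal (mtop M) \<alpha>" "continuous_map euclideanreal (mtop M) \<beta>"
    using \<alpha> \<beta> by (simp_all add: integral_curve_def)
  then have "\<alpha> t0 \<in> points M" by (auto simp: continuous_map_def)
  then obtain c where c: "c \<in> charts M" "\<alpha> t0 \<in> cdom c"
    using chart_around[OF M] by metis
  define X where "X x = T (cinv c x) c" for x
  have "smooth_on (cmap c ` cdom c) X"
    using T c(1) by (simp add: smooth_vector_field_def X_def[abs_def])
  then obtain e C where e: "e > 0" "C > 0" "ball (cmap c (\<alpha> t0)) e \<subseteq> cmap c ` cdom c"
    and lip: "\<And>x x'. x \<in> ball (cmap c (\<alpha> t0)) e \<Longrightarrow> x' \<in> ball (cmap c (\<alpha> t0)) e \<Longrightarrow>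
      norm (X x - X x') \<le> C * norm (x - x')"
    using smooth_on_local_lipschitz[OF _ chart_domain(3)[OF M c(1)] imageI[OF c(2)]] by metis
  let ?U = "{p \<in> cdom c. cmap c p \<in> ball (cmap c (\<alpha> t0)) e}"
  have U: "openin (mtop M) ?U" "\<alpha> t0 \<in> ?U" "\<beta> t0 \<in> ?U"
    using openin_chart_vimage[OF M c(1) open_ball] c(2) e(1) eq by auto
  obtain \<delta>1 where \<delta>1: "\<delta>1 > 0" "\<And>s. s \<in> ball t0 \<delta>1 \<Longrightarrow> \<alpha> s \<in> ?U"
    using continuous_curve_nhds[OF cont(1) U(1,2)] by metis
  obtain \<delta>2 where \<delta>2: "\<delta>2 > 0" "\<And>s. s \<in> ball t0 \<delta>2 \<Longrightarrow> \<beta> s \<in> ?U"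
    using continuous_curve_nhds[OF cont(2) U(1,3)] by metis
  \<comment> \<open>The halved radii put the closed interval inside the two open ones, where both
    curves stay in the chart ball; the last entry makes \<open>C * \<delta>\<close> at most
    1/2.\<close>
  define \<delta> where "\<delta> = min (min (\<delta>1 / 2) (\<delta>2 / 2)) (inverse (2 * C))"
  have \<delta>: "\<delta> > 0" "C * \<delta> \<le> 1 / 2"
  proof -
    show "\<delta> > 0" using \<delta>1 \<delta>2 e by (simp add: \<delta>_def)
    have "C * \<delta> \<le> C * inverse (2 * C)" using e by (intro mult_left_mono) (auto simp: \<delta>_def)
    then show "C * \<delta> \<le> 1 / 2" using e by simp
  qed
  have inU: "\<alpha> t \<in> ?U" "\<beta> t \<in> ?U" if "t \<in> cball t0 \<delta>" for t
  proof -
    have "\<delta> \<le> \<delta>1 / 2" "\<delta> \<le> \<delta>2 / 2" by (simp_all add: \<delta>_def)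
    then have "t \<in> ball t0 \<delta>1" "t \<in> ball t0 \<delta>2"
      using that \<delta>1(1) \<delta>2(1) by (simp_all add: mem_cball mem_ball)
    then show "\<alpha> t \<in> ?U" "\<beta> t \<in> ?U" using \<delta>1(2)[of t] \<delta>2(2)[of t] by simp_all
  qed
  define w where "w t = cmap c (\<alpha> t) - cmap c (\<beta> t)" for t
  define w' where "w' t = X (cmap c (\<alpha> t)) - X (cmap c (\<beta> t))" for t
  have dw: "(w has_vector_derivative w' t) (at t)" if "t \<in> cball t0 \<delta>" for t
  proof -
    have "c \<in> charts_at M (\<alpha> t)" "c \<in> charts_at M (\<beta> t)"
      using inU[OF that] c(1) by (simp_all add: charts_at_def)
    then have "((\<lambda>s. cmap c (\<alpha> s)) has_vector_derivative T (\<alpha> t) c) (at t)"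
      "((\<lambda>s. cmap c (\<beta> s)) has_vector_derivative T (\<beta> t) c) (at t)"
      using \<alpha> \<beta> unfolding integral_curve_def by blast+
    moreover have "T (\<alpha> t) c = X (cmap c (\<alpha> t))" "T (\<beta> t) c = X (cmap c (\<beta> t))"
      using inU[OF that] cinv_cmap[OF M c(1)] by (simp_all add: X_def)
    ultimately show ?thesis
      unfolding w_def[abs_def] w'_def by (simp add: has_vector_derivative_diff)
  qed
  have "continuous_on (cball t0 \<delta>) (\<lambda>t. norm (w t))"
    by (intro continuous_on_norm continuous_at_imp_continuous_on ballI has_vector_derivative_continuous[OF dw])
  then obtain s where s: "s \<in> cball t0 \<delta>" "\<And>t. t \<in> cball t0 \<delta> \<Longrightarrow> norm (w t) \<le> norm (w s)"
    using continuous_attains_sup[of "cball t0 \<delta>" "\<lambda>t. norm (w t)"] \<delta>(1) by auto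
  \<comment> \<open>Mean value inequality between \<open>t0\<close>, where \<open>w\<close>
    vanishes, and the maximum point \<open>s\<close>; the derivative is bounded by \<open>C\<close>
    times the maximum itself.\<close>
  have "norm (w s - w t0) \<le> (C * norm (w s)) * norm (s - t0)"
  proof (rule differentiable_bound[of "cball t0 \<delta>" w "\<lambda>t h. h *\<^sub>R w' t"])
    fix t assume t: "t \<in> cball t0 \<delta>"
    show "(w has_derivative (\<lambda>h. h *\<^sub>R w' t)) (at t within cball t0 \<delta>)"
      using dw[OF t] has_derivative_at_withinI unfolding has_vector_derivative_def by blast
    have "norm (w' t) \<le> C * norm (w t)"
      unfolding w'_def w_def using inU[OF t] by (intro lip) auto
    also have "\<dots> \<le> C * norm (w s)" using s(2)[OF t] e by (intro mult_left_mono) auto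
    finally have *: "norm (w' t) \<le> C * norm (w s)" .
    show "onorm (\<lambda>h. h *\<^sub>R w' t) \<le> C * norm (w s)"
    proof (rule onorm_bound)
      show "0 \<le> C * norm (w s)" using e by simp
      show "norm (h *\<^sub>R w' t) \<le> C * norm (w s) * norm h" for h :: real
        using mult_left_mono[OF *, of "\<bar>h\<bar>"] by (simp add: mult.commute)
    qed
  qed (use s \<delta> in auto)
  moreover have "w t0 = 0" using eq by (simp add: w_def)
  ultimately have "norm (w s) \<le> (C * norm (w s)) * norm (s - t0)" by simp
  also have "\<dots> \<le> (C * norm (w s)) * \<delta>"
    using s(1) e by (intro mult_left_mono) (auto simp: dist_norm norm_minus_commute)
  also have "\<dots> \<le> norm (w s) * (1 / 2)"
    using mult_left_mono[OF \<delta>(2), of "norm (w s)"] by (simp add: mult_ac)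
  finally have ws: "norm (w s) = 0" by simp
  show thesis
  proof
    show "\<delta> > 0" by fact
    fix t assume "t \<in> ball t0 \<delta>"
    then have t: "t \<in> cball t0 \<delta>" by auto
    then have "w t = 0" using s(2)[OF t] ws by simp
    then have "cmap c (\<alpha> t) = cmap c (\<beta> t)" by (simp add: w_def)
    then show "\<alpha> t = \<beta> t"
      using inU[OF t] chart_domain(4)[OF M c(1)] by (simp add: inj_on_def)
  qed
qed

text \<open>The times of agreement form a closed set because the manifold is Hausdorff and an open
  set by local uniqueness; the real line is connected.\<close>

lemma integral_curve_unique:
  assumes M: "smooth_manifold M" and T: "smooth_vector_field M T"
    and \<alpha>: "integral_curve M T \<alpha>" and \<beta>: "integral_curve M T \<beta>" and eq: "\<alpha> 0 = \<beta> 0"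
  shows "\<alpha> t = \<beta> t"
proof -
  define S where "S = {t. \<alpha> t = \<beta> t}"
  have "closedin euclideanreal {t \<in> topspace euclideanreal. \<alpha> t = \<beta> t}"
    using M \<alpha> \<beta> by (intro closedin_continuous_maps_eq[of "mtop M"]) (auto simp: smooth_manifold_def integral_curve_def)
  then have "closed S" by (simp add: S_def)
  moreover have "open S"
    unfolding open_contains_ball
  proof
    fix s assume "s \<in> S"
    then have "\<alpha> s = \<beta> s" by (simp add: S_def)
    then obtain \<delta> where "\<delta> > 0" "\<And>t. t \<in> ball s \<delta> \<Longrightarrow> \<alpha> t = \<beta> t"
      using integral_curves_locally_equal[OF M T \<alpha> \<beta>] by metis
    then show "\<exists>e>0. ball s e \<subseteq> S" unfolding S_def by blast
  qed
  moreover have "S \<noteq> {}" using eq by (auto simp: S_def)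
  ultimately have "S = UNIV" using clopen[of S] by blast
  then show ?thesis by (auto simp: S_def)
qed

lemma open_local_domain:
  assumes M: "smooth_manifold M" and F: "continuous_map (mtop M) (mtop M') F" and M': "smooth_manifold M'"
    and c: "c \<in> charts M" "c' \<in> charts M'"
  shows "openin (mtop M) {p \<in> cdom c. F p \<in> cdom c'}"
proof -
  have "openin (mtop M) (cdom c \<inter> {p \<in> points M. F p \<in> cdom c'})"
    using chart_domain(1)[OF M c(1)] chart_domain(1)[OF M' c(2)]
    by (intro openin_Int openin_continuous_map_preimage[OF F])
  moreover have "cdom c \<inter> {p \<in> points M. F p \<in> cdom c'} = {p \<in> cdom c. F p \<in> cdom c'}"
    using chart_domain(2)[OF M c(1)] by auto
  ultimately show ?thesis by simp
qed

lemma smooth_map_local_rep: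
  assumes M: "smooth_manifold M" and M': "smooth_manifold M'" and F: "smooth_map M M' F"
    and c: "c \<in> charts M" "c' \<in> charts M'"
  shows "open (cmap c ` {p \<in> cdom c. F p \<in> cdom c'})"
    "smooth_on (cmap c ` {p \<in> cdom c. F p \<in> cdom c'}) (cmap c' \<circ> F \<circ> cinv c)"
    "p \<in> cdom c \<Longrightarrow> F p \<in> cdom c' \<Longrightarrow>
      ((cmap c' \<circ> F \<circ> cinv c) has_derivative frechet_derivative (cmap c' \<circ> F \<circ> cinv c) (at (cmap c p))) (at (cmap c p))"
proof -
  have cont: "continuous_map (mtop M) (mtop M') F" using F by (simp add: smooth_map_def)
  show "open (cmap c ` {p \<in> cdom c. F p \<in> cdom c'})"
    using open_chart_image[OF M c(1) open_local_domain[OF M cont M' c]] by auto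
  show *: "smooth_on (cmap c ` {p \<in> cdom c. F p \<in> cdom c'}) (cmap c' \<circ> F \<circ> cinv c)"
    using F c by (simp add: smooth_map_def)
  assume p: "p \<in> cdom c" "F p \<in> cdom c'"
  then have "(cmap c' \<circ> F \<circ> cinv c) differentiable (at (cmap c p))"
    using smooth_on_C1[OF *] unfolding differentiable_def by (metis (mono_tags, lifting) imageI mem_Collect_eq)
  then show "((cmap c' \<circ> F \<circ> cinv c) has_derivative frechet_derivative (cmap c' \<circ> F \<circ> cinv c) (at (cmap c p))) (at (cmap c p))"
    by (simp add: frechet_derivative_works)
qed

text \<open>The image under \<open>f\<close> of a flow line solves the same equation, as
  \<open>f\<close> carries \<open>T\<close> to \<open>T\<close>, so uniqueness identifies it with
  the flow line of \<open>f p\<close>.\<close>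

lemma map_commutes_with_flow:
  assumes M: "smooth_manifold M" and T: "smooth_vector_field M T" and flow: "global_flow M T \<Phi>"
    and f: "smooth_map M M f" "\<forall>p\<in>points M. differential M M f p (T p) = T (f p)"
    and p: "p \<in> points M"
  shows "f (\<Phi> t p) = \<Phi> t (f p)"
proof -
  have contf: "continuous_map (mtop M) (mtop M) f" using f(1) by (simp add: smooth_map_def)
  then have fp: "f p \<in> points M" using p by (auto simp: continuous_map_def)
  have curve: "integral_curve M T (\<lambda>t. \<Phi> t q)" "\<Phi> 0 q = q" if "q \<in> points M" for q
    using flow that by (simp_all add: global_flow_def integral_curve_def)
  have cont: "continuous_map euclideanreal (mtop M) (\<lambda>t. \<Phi> t p)"
    using curve(1)[OF p] by (simp add: integral_curve_def)
  have "integral_curve M T (\<lambda>t. f (\<Phi> t p))"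
    unfolding integral_curve_def
  proof (intro conjI allI ballI)
    show "continuous_map euclideanreal (mtop M) (\<lambda>t. f (\<Phi> t p))"
      using continuous_map_compose[OF cont contf] by (simp add: comp_def)
    fix t c' assume c': "c' \<in> charts_at M (f (\<Phi> t p))"
    have q: "\<Phi> t p \<in> points M" using cont by (auto simp: continuous_map_def)
    \<comment> \<open>The very chart that \<open>differential\<close> selects; any other would have
      to be related to it through a transition map.\<close>
    define c where "c = (SOME c. c \<in> charts_at M (\<Phi> t p))"
    have c: "c \<in> charts_at M (\<Phi> t p)"
      unfolding c_def using charts_at_nonempty[OF M q] by (metis someI)
    let ?F = "cmap c' \<circ> f \<circ> cinv c"
    have "((\<lambda>s. cmap c (\<Phi> s p)) has_vector_derivative T (\<Phi> t p) c) (at t)"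
      using curve(1)[OF p] c unfolding integral_curve_def by blast
    moreover have "(?F has_derivative frechet_derivative ?F (at (cmap c (\<Phi> t p)))) (at (cmap c (\<Phi> t p)))"
      using c c' by (intro smooth_map_local_rep(3)[OF M M f(1)]) (auto dest: charts_atD)
    ultimately have "((?F \<circ> (\<lambda>s. cmap c (\<Phi> s p))) has_vector_derivative
        frechet_derivative ?F (at (cmap c (\<Phi> t p))) (T (\<Phi> t p) c)) (at t)"
      using vector_derivative_diff_chain_within has_derivative_at_withinI by blast
    moreover have "frechet_derivative ?F (at (cmap c (\<Phi> t p))) (T (\<Phi> t p) c) = T (f (\<Phi> t p)) c'"
    proof -
      have "T (f (\<Phi> t p)) c' = differential M M f (\<Phi> t p) (T (\<Phi> t p)) c'" using f(2) q by simp
      then show ?thesis using c' by (simp add: differential_def Let_def c_def)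
    qed
    ultimately have D: "((?F \<circ> (\<lambda>s. cmap c (\<Phi> s p))) has_vector_derivative T (f (\<Phi> t p)) c') (at t)"
      by simp
    obtain \<delta> where \<delta>: "\<delta> > 0" "\<And>s. s \<in> ball t \<delta> \<Longrightarrow> \<Phi> s p \<in> cdom c"
      using continuous_curve_nhds[OF cont chart_domain(1)[OF M charts_atD(1)[OF c]] charts_atD(2)[OF c]] by metis
    show "((\<lambda>s. cmap c' (f (\<Phi> s p))) has_vector_derivative T (f (\<Phi> t p)) c') (at t)"
    proof (rule has_vector_derivative_transform_within_open[OF D open_ball])
      show "t \<in> ball t \<delta>" using \<delta> by simp
      show "(?F \<circ> (\<lambda>s. cmap c (\<Phi> s p))) s = cmap c' (f (\<Phi> s p))" if "s \<in> ball t \<delta>" for s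
        using cinv_cmap[OF M charts_atD(1)[OF c] \<delta>(2)[OF that]] by simp
    qed
  qed
  then show ?thesis
    by (rule integral_curve_unique[OF M T _ curve(1)[OF fp]]) (simp add: curve(2) p fp)
qed

section \<open>From the flow to its closure in the isometry group\<close>

lemma isometry_in_compact_open:
  assumes "h \<in> isometries M \<g>"
  shows "h \<in> extensional (points M)" "continuous_map (mtop M) (mtop M) h"
  using assms by (auto simp: isometries_def Bij_def smooth_map_def)

text \<open>A single point is compact, so the condition that \<open>h p\<close> lies in a given open
  set is subbasic in the compact-open topology.\<close>

lemma continuous_map_evaluation:
  assumes p: "p \<in> points M"
  shows "continuous_map (isometry_topology M \<g>) (mtop M) (\<lambda>h. h p)"
  unfolding continuous_map_def
proof (intro conjI allI impI)
  have top: "topspace (isometry_topology M \<g>) \<subseteq> isometries M \<g>"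
    by (auto simp: isometry_topology_def)
  then show "(\<lambda>h. h p) \<in> topspace (isometry_topology M \<g>) \<rightarrow> points M"
    using isometry_in_compact_open(2) p by (fastforce simp: continuous_map_def)
  fix U assume U: "openin (mtop M) U"
  let ?B = "{h \<in> extensional (points M). continuous_map (mtop M) (mtop M) h \<and> h ` {p} \<subseteq> U}"
  have B: "openin (compact_open_topology (mtop M) (mtop M)) ?B"
    unfolding compact_open_topology_def
  proof (rule topology_generated_by_Basis)
    have "compactin (mtop M) {p}" using p by (simp add: finite_imp_compactin)
    then show "?B \<in> {{h \<in> extensional (points M). continuous_map (mtop M) (mtop M) h \<and> h ` K \<subseteq> U} | K U.
        compactin (mtop M) K \<and> openin (mtop M) U}"
      using U by blast
  qed
  have "{h \<in> topspace (isometry_topology M \<g>). h p \<in> U} = ?B \<inter> isometries M \<g>"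
  proof (intro equalityI subsetI)
    fix h assume "h \<in> {h \<in> topspace (isometry_topology M \<g>). h p \<in> U}"
    then have "h \<in> isometries M \<g>" "h p \<in> U" using top by auto
    then show "h \<in> ?B \<inter> isometries M \<g>" using isometry_in_compact_open by auto
  next
    fix h assume "h \<in> ?B \<inter> isometries M \<g>"
    then show "h \<in> {h \<in> topspace (isometry_topology M \<g>). h p \<in> U}"
      using openin_subset[OF B] by (auto simp: isometry_topology_def)
  qed
  then show "openin (isometry_topology M \<g>) {h \<in> topspace (isometry_topology M \<g>). h p \<in> U}"
    using B unfolding isometry_topology_def openin_subtopology by blast
qed

text \<open>For fixed \<open>p\<close> both sides are continuous in \<open>h\<close> with values in
  a Hausdorff space, so the identity is a closed condition; it holds on the flow and therefore on
  its closure.\<close>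

lemma map_commutes_with_flow_closure:
  assumes M: "smooth_manifold M" and f: "continuous_map (mtop M) (mtop M) f"
    and comm: "\<And>t p. p \<in> points M \<Longrightarrow> f (\<Phi> t p) = \<Phi> t (f p)"
    and h: "h \<in> flow_closure M \<g> \<Phi>" and p: "p \<in> points M"
  shows "f (h p) = h (f p)"
proof -
  let ?X = "isometry_topology M \<g>" and ?S = "range (\<lambda>t. restrict (\<Phi> t) (points M))"
  have fp: "f p \<in> points M" using f p by (auto simp: continuous_map_def)
  have "closedin ?X {h \<in> topspace ?X. (f \<circ> (\<lambda>h. h p)) h = (\<lambda>h. h (f p)) h}"
    using M by (intro closedin_continuous_maps_eq[of "mtop M"] continuous_map_evaluation[OF fp]
        continuous_map_compose[OF continuous_map_evaluation[OF p] f]) (simp add: smooth_manifold_def)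
  moreover have "topspace ?X \<inter> ?S \<subseteq> {h \<in> topspace ?X. (f \<circ> (\<lambda>h. h p)) h = (\<lambda>h. h (f p)) h}"
    using comm p fp by auto
  ultimately have "?X closure_of (topspace ?X \<inter> ?S) \<subseteq> {h \<in> topspace ?X. (f \<circ> (\<lambda>h. h p)) h = (\<lambda>h. h (f p)) h}"
    by (intro closure_of_minimal)
  moreover have "h \<in> ?X closure_of (topspace ?X \<inter> ?S)"
    using h unfolding flow_closure_def by (subst (asm) closure_of_restrict)
  ultimately show ?thesis by auto
qed

section \<open>Zeros of the defect\<close>

locale equivariant_map = compact_abelian_action N \<G>
  for N :: "('a, 'e::euclidean_space) manifold" and \<G> :: "('a \<Rightarrow> 'a, 'h::euclidean_space) manifold" +
  fixes f :: "'a \<Rightarrow> 'a"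
  assumes f: "smooth_map N N f"
    and f_commute: "g \<in> points \<G> \<Longrightarrow> p \<in> points N \<Longrightarrow> f (g p) = g (f p)"
begin

text \<open>Subtraction needs one chart around both \<open>g p\<close> and \<open>f p\<close>;
  \<open>c'\<close> is that chart. Injectivity of \<open>c'\<close> makes the zeros on
  \<open>defect_dom\<close> exactly the solutions of \<open>g p = f p\<close>.\<close>

definition defect :: "('a, 'e) chart \<Rightarrow> ('a \<Rightarrow> 'a, 'h) chart \<Rightarrow> ('a, 'e) chart \<Rightarrow> 'e \<times> 'h \<Rightarrow> 'e" where
  "defect c d c' z = act_rep c d c' z - (cmap c' \<circ> f \<circ> cinv c) (fst z)"

definition defect_dom :: "('a, 'e) chart \<Rightarrow> ('a \<Rightarrow> 'a, 'h) chart \<Rightarrow> ('a, 'e) chart \<Rightarrow> ('e \<times> 'h) set" where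
  "defect_dom c d c' = act_dom c d c' \<inter> (cmap c ` {p \<in> cdom c. f p \<in> cdom c'}) \<times> UNIV"

lemma open_defect_dom:
  assumes "c \<in> charts N" "d \<in> charts \<G>" "c' \<in> charts N"
  shows "open (defect_dom c d c')"
  unfolding defect_dom_def
  by (intro open_Int open_Times open_act_dom assms smooth_map_local_rep(1)[OF N N f] open_UNIV)

lemma defect_domI:
  "p \<in> cdom c \<Longrightarrow> g \<in> cdom d \<Longrightarrow> g p \<in> cdom c' \<Longrightarrow> f p \<in> cdom c' \<Longrightarrow> (cmap c p, cmap d g) \<in> defect_dom c d c'"
  unfolding defect_dom_def using act_domI by blast

lemma defect_domE:
  assumes "c \<in> charts N" "d \<in> charts \<G>" "(x, y) \<in> defect_dom c d c'"
  obtains p g where "p \<in> cdom c" "g \<in> cdom d" "x = cmap c p" "y = cmap d g" "g p \<in> cdom c'" "f p \<in> cdom c'"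
    "cinv c x = p" "cinv d y = g"
proof -
  have dom: "(x, y) \<in> act_dom c d c'" and "x \<in> cmap c ` {p \<in> cdom c. f p \<in> cdom c'}"
    using assms(3) by (simp_all add: defect_dom_def)
  then obtain p where p: "p \<in> cdom c" "f p \<in> cdom c'" "x = cmap c p" by auto
  obtain g where g: "g \<in> cdom d" "y = cmap d g" using act_domE(2)[OF assms(1,2) dom] by auto
  have "cinv c x = p" "cinv d y = g"
    using p g cinv_cmap[OF N assms(1)] cinv_cmap[OF \<G> assms(2)] by simp_all
  then show thesis using that p g act_domE(3)[OF assms(1,2) dom] by simp
qed

lemma defect_eq:
  assumes "c \<in> charts N" "d \<in> charts \<G>" "p \<in> cdom c" "g \<in> cdom d" "g p \<in> cdom c'"
  shows "defect c d c' (cmap c p, cmap d g) = cmap c' (g p) - cmap c' (f p)"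
  using act_rep_eq[OF assms(1,2) act_domI[OF assms(3-5)]] cinv_cmap[OF N assms(1,3)] cinv_cmap[OF \<G> assms(2,4)]
  by (simp add: defect_def)

lemma defect_C1:
  assumes c: "c \<in> charts N" "d \<in> charts \<G>" "c' \<in> charts N"
  obtains F' where
    "\<And>z. z \<in> defect_dom c d c' \<Longrightarrow> (defect c d c' has_derivative blinfun_apply (F' z)) (at z)"
    "continuous_on (defect_dom c d c') F'"
proof -
  let ?S = "cmap c ` {p \<in> cdom c. f p \<in> cdom c'}" and ?f = "cmap c' \<circ> f \<circ> cinv c"
  obtain A' where A': "\<And>z. z \<in> act_dom c d c' \<Longrightarrow> (act_rep c d c' has_derivative blinfun_apply (A' z)) (at z)"
    "continuous_on (act_dom c d c') A'"
    using smooth_on_C1[OF smooth_act_rep[OF c]] by blast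
  obtain B' where B': "\<And>x. x \<in> ?S \<Longrightarrow> (?f has_derivative blinfun_apply (B' x)) (at x)" "continuous_on ?S B'"
    using smooth_on_C1[OF smooth_map_local_rep(2)[OF N N f c(1,3)]] by blast
  define pr :: "('e \<times> 'h) \<Rightarrow>\<^sub>L 'e" where "pr = Blinfun fst"
  have pr: "blinfun_apply pr = fst"
    by (simp add: pr_def bounded_linear_Blinfun_apply bounded_linear_fst)
  show thesis
  proof
    fix z assume z: "z \<in> defect_dom c d c'"
    then have "fst z \<in> ?S" "z \<in> act_dom c d c'" by (auto simp: defect_dom_def)
    then have "((\<lambda>z. act_rep c d c' z - ?f (fst z)) has_derivative (\<lambda>h. A' z h - B' (fst z) (fst h))) (at z)"
      by (intro has_derivative_diff A' has_derivative_compose[OF has_derivative_fst[OF has_derivative_ident] B'(1)])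
    moreover have "(\<lambda>h. A' z h - B' (fst z) (fst h)) = blinfun_apply (A' z - (B' (fst z) o\<^sub>L pr))"
      by (simp add: blinfun.diff_left pr fun_eq_iff)
    ultimately show "(defect c d c' has_derivative blinfun_apply (A' z - (B' (fst z) o\<^sub>L pr))) (at z)"
      by (simp add: defect_def[abs_def])
  next
    have "continuous_on (defect_dom c d c') A'"
      using A'(2) by (rule continuous_on_subset) (simp add: defect_dom_def)
    moreover have "continuous_on (defect_dom c d c') (\<lambda>z. B' (fst z))"
      by (rule continuous_on_compose2[OF B'(2)]) (auto simp: defect_dom_def intro: continuous_intros)
    ultimately show "continuous_on (defect_dom c d c') (\<lambda>z. A' z - (B' (fst z) o\<^sub>L pr))"
      by (intro continuous_intros)
  qed
qed

text \<open>At a zero of the defect, moving along the orbit of \<open>p\<close> and moving \<open>g\<close> along the stabilizer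
  already exhaust the kernel of the differential, because their dimensions add up to \<open>dim G\<close>.\<close>

lemma kernel_tangent_to_orbit:
  assumes c: "c \<in> charts N" "d \<in> charts \<G>" "c' \<in> charts N"
    and dom: "(x, y) \<in> defect_dom c d c'" and zero: "defect c d c' (x, y) = 0"
    and L: "(defect c d c' has_derivative L) (at (x, y))" "surj L" "L (u, w) = 0"
  obtains \<beta> where "(\<beta> has_vector_derivative u) (at 0)" "\<beta> 0 = x"
    "\<forall>\<^sub>F s in at 0. cinv c (\<beta> s) \<in> orbit (cinv c x)"
proof -
  obtain p g where p: "p \<in> cdom c" "g \<in> cdom d" "x = cmap c p" "y = cmap d g" "g p \<in> cdom c'" "f p \<in> cdom c'"
    "cinv c x = p" "cinv d y = g"
    using defect_domE[OF c(1,2) dom] by metis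
  have pN: "p \<in> points N" and gG: "g \<in> points \<G>"
    using p chart_domain(2)[OF N c(1)] chart_domain(2)[OF \<G> c(2)] by auto
  have "cmap c' (g p) = cmap c' (f p)"
    using zero defect_eq[OF c(1,2) p(1,2,5)] p(3,4) by simp
  then have fp: "f p = g p"
    using chart_domain(4)[OF N c(3)] p(5,6) by (simp add: inj_on_def)
  obtain k where k: "k \<in> points \<G>" "\<And>q. q \<in> points N \<Longrightarrow> k (g q) = q"
    using inverse[OF gG] by blast
  \<comment> \<open>The locale supplies an inverse on one side; commutativity gives the
    other.\<close>
  have gk: "g (k q) = q" if "q \<in> points N" for q
    using commute[OF gG k(1) that] k(2)[OF that] by simp
  define S where "S = cmap c' ` {q \<in> cdom c'. k q \<in> cdom c}"
  define m where "m = cmap c \<circ> k \<circ> cinv c'"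
  define M where "M = frechet_derivative m (at (cmap c' (g p)))"
  have openS: "open S"
    unfolding S_def by (rule smooth_map_local_rep(1)[OF N N element[OF k(1)] c(3,1)])
  have gpS: "cmap c' (g p) \<in> S"
    using p pN k(2) by (auto simp: S_def)
  have M: "(m has_derivative M) (at (cmap c' (g p)))"
    unfolding M_def m_def using p pN k(2) by (intro smooth_map_local_rep(3)[OF N N element[OF k(1)] c(3,1)]) auto
  have m_eq: "m (cmap c' q) = cmap c (k q)" if "q \<in> cdom c'" for q
    using cinv_cmap[OF N c(3) that] by (simp add: m_def)
  have linM: "linear M" using M has_derivative_linear by blast
  have linL: "linear L" using L(1) has_derivative_linear by blast
  \<comment> \<open>\<open>mi\<close> represents \<open>g\<close> and undoes \<open>m\<close> near
    \<open>g p\<close>. Differentiating this identity gives \<open>M\<close> a left inverse, so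
    passing from \<open>g p\<close> back to \<open>p\<close> loses no dimension.\<close>
  define mi where "mi = cmap c' \<circ> g \<circ> cinv c"
  have "(mi has_derivative frechet_derivative mi (at (cmap c p))) (at (cmap c p))"
    unfolding mi_def using p by (intro smooth_map_local_rep(3)[OF N N element[OF gG] c(1,3)]) auto
  moreover have "m (cmap c' (g p)) = cmap c p"
    using m_eq[OF p(5)] k(2)[OF pN] by simp
  ultimately have "((\<lambda>\<xi>. mi (m \<xi>)) has_derivative (\<lambda>v. frechet_derivative mi (at (cmap c p)) (M v))) (at (cmap c' (g p)))"
    using has_derivative_compose[OF M] by simp
  moreover have "((\<lambda>\<xi>. mi (m \<xi>)) has_derivative (\<lambda>v. v)) (at (cmap c' (g p)))"
  proof (rule has_derivative_transform_within_open[OF has_derivative_ident openS gpS])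
    fix \<xi> assume "\<xi> \<in> S"
    then obtain q where q: "q \<in> cdom c'" "k q \<in> cdom c" "\<xi> = cmap c' q" by (auto simp: S_def)
    then show "\<xi> = mi (m \<xi>)"
      using m_eq[OF q(1)] cinv_cmap[OF N c(1) q(2)] gk chart_domain(2)[OF N c(3)] by (auto simp: mi_def)
  qed
  ultimately have "(\<lambda>v. frechet_derivative mi (at (cmap c p)) (M v)) = (\<lambda>v. v)"
    by (rule has_derivative_unique)
  then have injM: "inj M"
    by (metis injI)
  \<comment> \<open>\<alpha> moves the group coordinate along a line with \<open>p\<close> fixed,
    and so runs in the orbit near \<open>g p\<close>; applying \<open>k\<close> gives \<beta>, which
    runs in the same orbit and starts at \<open>p\<close>.\<close>
  define \<alpha> where "\<alpha> v s = act_rep c d c' (x, y + s *\<^sub>R v)" for v and s :: real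
  define \<beta> where "\<beta> v s = m (\<alpha> v s)" for v s
  have \<alpha>0: "\<alpha> v 0 = cmap c' (g p)" for v
    using act_rep_eq[OF c(1,2) act_domI[OF p(1,2,5)]] p by (simp add: \<alpha>_def)
  have line: "((\<lambda>s. (x, y + s *\<^sub>R v)) has_vector_derivative (0, v)) (at 0)" for v
    by (auto intro!: derivative_eq_intros simp: has_vector_derivative_def)
  \<comment> \<open>The term of the defect involving \<open>f\<close> does not depend on the group
    coordinate, so in the direction \<open>(0, v)\<close> the action has the same derivative as the
    defect.\<close>
  have d\<alpha>: "(\<alpha> v has_vector_derivative L (0, v)) (at 0)" for v
  proof -
    have "(defect c d c' has_derivative L) (at ((\<lambda>s. (x, y + s *\<^sub>R v)) (0::real)) within range (\<lambda>s. (x, y + s *\<^sub>R v)))"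
      using L(1) has_derivative_at_withinI by auto
    from vector_derivative_diff_chain_within[OF line this]
    have "((\<lambda>s. defect c d c' (x, y + s *\<^sub>R v)) has_vector_derivative L (0, v)) (at 0)"
      by (simp add: comp_def)
    then have "((\<lambda>s. defect c d c' (x, y + s *\<^sub>R v) + (cmap c' \<circ> f \<circ> cinv c) x) has_vector_derivative L (0, v) + 0) (at 0)"
      by (intro has_vector_derivative_add has_vector_derivative_const)
    then show ?thesis by (simp add: defect_def \<alpha>_def[abs_def])
  qed
  have d\<beta>: "(\<beta> v has_vector_derivative M (L (0, v))) (at 0)" for v
  proof -
    have "(m has_derivative M) (at (\<alpha> v 0) within range (\<alpha> v))"
      using M \<alpha>0 has_derivative_at_withinI by metis
    from vector_derivative_diff_chain_within[OF d\<alpha> this]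
    show ?thesis by (simp add: comp_def \<beta>_def[abs_def])
  qed
  have \<beta>0: "\<beta> v 0 = x" for v
    using \<alpha>0 m_eq[OF p(5)] k(2)[OF pN] p(3) by (simp add: \<beta>_def)
  have near: "\<forall>\<^sub>F s in at 0. \<exists>h\<in>points \<G>. k (h p) \<in> cdom c \<and> \<beta> v s = cmap c (k (h p))" for v
  proof -
    have "((\<lambda>s. (x, y + s *\<^sub>R v)) \<longlongrightarrow> (x, y)) (at 0)"
      using has_vector_derivative_continuous[OF line] by (simp add: continuous_at)
    then have "\<forall>\<^sub>F s in at 0. (x, y + s *\<^sub>R v) \<in> act_dom c d c'"
      using open_act_dom[OF c] dom by (elim topological_tendstoD) (auto simp: defect_dom_def)
    moreover have "(\<alpha> v \<longlongrightarrow> cmap c' (g p)) (at 0)"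
      using has_vector_derivative_continuous[OF d\<alpha>[of v]] \<alpha>0[of v] by (simp add: continuous_at)
    then have "\<forall>\<^sub>F s in at 0. \<alpha> v s \<in> S"
      using openS gpS by (elim topological_tendstoD)
    ultimately show ?thesis
    proof eventually_elim
      case (elim s)
      define h where "h = cinv d (y + s *\<^sub>R v)"
      have y: "y + s *\<^sub>R v \<in> cmap d ` cdom d" and hp: "h p \<in> cdom c'"
        using act_domE(2,3)[OF c(1,2) elim(1)] p(7) by (simp_all add: h_def)
      have h: "h \<in> points \<G>"
        using chart_inverse(1)[OF y] chart_domain(2)[OF \<G> c(2)] by (auto simp: h_def)
      have \<alpha>: "\<alpha> v s = cmap c' (h p)"
        using act_rep_eq[OF c(1,2) elim(1)] p(7) by (simp add: \<alpha>_def h_def)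
      then obtain q where "q \<in> cdom c'" "k q \<in> cdom c" "cmap c' (h p) = cmap c' q"
        using elim(2) by (auto simp: S_def)
      then have "k (h p) \<in> cdom c"
        using hp chart_domain(4)[OF N c(3)] by (metis inj_onD)
      moreover have "\<beta> v s = cmap c (k (h p))"
        using \<alpha> m_eq[OF hp] by (simp add: \<beta>_def)
      ultimately show ?case using h by blast
    qed
  qed
  \<comment> \<open>With \<open>g\<close> fixed, the points \<open>k (h p)\<close> are zeros:
    \<open>f (k (h p)) = k (h (g p)) = h p = g (k (h p))\<close>, because \<open>f p = g p\<close>
    and everything commutes. So the defect vanishes along \<open>(\<beta> v s, y)\<close> and its
    differential kills the velocity.\<close>
  have kernel: "L (M (L (0, v)), 0) = 0" for v
  proof -
    have d: "((\<lambda>s. (\<beta> v s, y)) has_vector_derivative (M (L (0, v)), 0)) (at 0)"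
      using d\<beta>[of v] unfolding has_vector_derivative_def
      by (auto intro!: derivative_eq_intros)
    have "(defect c d c' has_derivative L) (at ((\<lambda>s. (\<beta> v s, y)) 0) within range (\<lambda>s. (\<beta> v s, y)))"
      using L(1) \<beta>0 has_derivative_at_withinI by auto
    from vector_derivative_diff_chain_within[OF d this]
    have D: "((\<lambda>s. defect c d c' (\<beta> v s, y)) has_vector_derivative L (M (L (0, v)), 0)) (at 0)"
      by (simp add: comp_def)
    have "((\<lambda>s. (\<beta> v s, y)) \<longlongrightarrow> (x, y)) (at 0)"
      using has_vector_derivative_continuous[OF d] \<beta>0 by (simp add: continuous_at)
    then have "\<forall>\<^sub>F s in at 0. (\<beta> v s, y) \<in> defect_dom c d c'"
      using open_defect_dom[OF c] dom by (elim topological_tendstoD)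
    with near[of v] have ev: "\<forall>\<^sub>F s in at 0. defect c d c' (\<beta> v s, y) = 0"
    proof eventually_elim
      case (elim s)
      then obtain h where h: "h \<in> points \<G>" "k (h p) \<in> cdom c" "\<beta> v s = cmap c (k (h p))" by blast
      have hp: "h p \<in> points N" by (rule action_points[OF h(1) pN])
      have "cinv c (\<beta> v s) = k (h p)" using cinv_cmap[OF N c(1) h(2)] h(3) by simp
      then have "g (k (h p)) \<in> cdom c'"
        using act_domE(3)[OF c(1,2), of "\<beta> v s" y c'] elim(2) p(8) by (simp add: defect_dom_def)
      then have "defect c d c' (\<beta> v s, y) = cmap c' (g (k (h p))) - cmap c' (f (k (h p)))"
        using defect_eq[OF c(1,2) h(2) p(2)] h(3) p(4) by simp
      moreover have "f (k (h p)) = k (h (g p))"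
        using f_commute k(1) h(1) pN hp fp by simp
      moreover have "k (h (g p)) = h p"
        using commute[OF h(1) gG pN] k(2)[OF hp] by simp
      ultimately show ?case using gk[OF hp] by simp
    qed
    have "\<forall>\<^sub>F s in nhds 0. s \<in> UNIV \<longrightarrow> defect c d c' (\<beta> v s, y) = 0"
      using ev unfolding eventually_at_filter
    proof eventually_elim
      case (elim s)
      then show ?case using \<beta>0 zero by (cases "s = 0") auto
    qed
    then have "((\<lambda>s. 0) has_vector_derivative L (M (L (0, v)), 0)) (at (0::real))"
      using has_vector_derivative_cong_ev[of UNIV "\<lambda>s. defect c d c' (\<beta> v s, y)" "\<lambda>_. 0" 0] D \<beta>0 zero by simp
    then show ?thesis by (metis has_vector_derivative_const vector_derivative_unique_at)
  qed
  obtain v where "u = M (L (0, v))"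
    using kernel_fst_tangent[OF linL L(2) refl linM injM kernel L(3)] by blast
  moreover have "\<forall>\<^sub>F s in at 0. cinv c (\<beta> v s) \<in> orbit (cinv c x)" for v
    using near[of v]
  proof eventually_elim
    case (elim s)
    then obtain h where h: "h \<in> points \<G>" "k (h p) \<in> cdom c" "\<beta> v s = cmap c (k (h p))" by blast
    obtain l where "l \<in> points \<G>" "\<forall>q\<in>points N. l q = k (h q)" using mult[OF k(1) h(1)] by blast
    then have "k (h p) \<in> orbit p" using pN unfolding orbit_def by (metis image_eqI)
    then show ?case using cinv_cmap[OF N c(1) h(2)] h(3) p(7) by simp
  qed
  ultimately show thesis using that[of "\<beta> v"] d\<beta> \<beta>0 by simp
qed

text \<open>Surjectivity holds throughout the neighbourhood from \<open>zero_set_path\<close>, so at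
  every time of the connecting path the velocity is a kernel vector of a surjective differential,
  and its component in \<open>N\<close> is tangent to an orbit. The group component is
  discarded.\<close>

lemma zero_set_in_orbit:
  assumes c: "c \<in> charts N" "d \<in> charts \<G>" "c' \<in> charts N"
    and p0: "p0 \<in> cdom c" "g0 \<in> cdom d" "f p0 = g0 p0" "f p0 \<in> cdom c'"
    and L: "(defect c d c' has_derivative L) (at (cmap c p0, cmap d g0))" "surj L"
  obtains U where "open U" "(cmap c p0, cmap d g0) \<in> U" "U \<subseteq> defect_dom c d c'"
    "\<And>x y. (x, y) \<in> U \<Longrightarrow> defect c d c' (x, y) = 0 \<Longrightarrow> cinv c x \<in> orbit p0"
proof -
  let ?z0 = "(cmap c p0, cmap d g0)"
  obtain F' where F': "\<And>z. z \<in> defect_dom c d c' \<Longrightarrow> (defect c d c' has_derivative blinfun_apply (F' z)) (at z)"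
    "continuous_on (defect_dom c d c') F'"
    using defect_C1[OF c] by blast
  have z0: "?z0 \<in> defect_dom c d c'" using p0 by (intro defect_domI) auto
  have "blinfun_apply (F' ?z0) = L" using F'(1)[OF z0] L(1) by (rule has_derivative_unique)
  then have surj: "surj (blinfun_apply (F' ?z0))" using L(2) by simp
  have F0: "defect c d c' ?z0 = 0"
    using defect_eq[OF c(1,2) p0(1,2)] p0(3,4) by simp
  obtain U where U: "open U" "?z0 \<in> U" "U \<subseteq> defect_dom c d c'" "\<And>z. z \<in> U \<Longrightarrow> surj (blinfun_apply (F' z))"
    and path: "\<And>z. z \<in> U \<Longrightarrow> defect c d c' z = 0 \<Longrightarrow>
       \<exists>\<gamma> \<gamma>'. \<gamma> 0 = ?z0 \<and> \<gamma> 1 = z \<and> (\<forall>t\<in>{0..1}. \<gamma> t \<in> U \<and> defect c d c' (\<gamma> t) = 0 \<and>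
         (\<gamma> has_vector_derivative \<gamma>' t) (at t within {0..1::real}))"
    by (rule zero_set_path[OF open_defect_dom[OF c] z0 F' surj F0]) (assumption | rule that)+
  have p0N: "p0 \<in> points N" using p0(1) chart_domain(2)[OF N c(1)] by auto
  show thesis
  proof (rule that[OF U(1-3)])
    fix x y assume xy: "(x, y) \<in> U" "defect c d c' (x, y) = 0"
    obtain \<gamma> \<gamma>' where \<gamma>: "\<gamma> 0 = ?z0" "\<gamma> 1 = (x, y)"
      "\<And>t. t \<in> {0..1} \<Longrightarrow> \<gamma> t \<in> U" "\<And>t. t \<in> {0..1} \<Longrightarrow> defect c d c' (\<gamma> t) = 0"
      "\<And>t. t \<in> {0..1} \<Longrightarrow> (\<gamma> has_vector_derivative \<gamma>' t) (at t within {0..1::real})"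
      using path[OF xy] by blast
    show "cinv c x \<in> orbit p0"
    proof (rule ccontr)
      assume contra: "cinv c x \<notin> orbit p0"
      have "(x, y) \<in> defect_dom c d c'" using xy(1) U(3) by blast
      then obtain p where "p \<in> cdom c" "cinv c x = p" using defect_domE[OF c(1,2)] by metis
      then have "cinv c x \<in> points N" using chart_domain(2)[OF N c(1)] by auto
      \<comment> \<open>One invariant function telling \<open>p0\<close> from the end point
        suffices; it may depend on that end point.\<close>
      then obtain u where u: "\<And>g p. g \<in> points \<G> \<Longrightarrow> p \<in> points N \<Longrightarrow> u (g p) = u p"
        "locally_lipschitz N u" "u p0 \<noteq> u (cinv c x)"
        using orbit_separation[OF p0N _ contra] by blast
      have "((\<lambda>s. u (cinv c (fst (\<gamma> s)))) has_derivative (\<lambda>_. 0)) (at t within {0..1})" if t: "t \<in> {0..1}" for t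
      proof -
        obtain x1 y1 where z: "\<gamma> t = (x1, y1)" by fastforce
        have dom: "(x1, y1) \<in> defect_dom c d c'" using \<gamma>(3)[OF t] U(3) z by auto
        obtain p1 where p1: "p1 \<in> cdom c" "x1 = cmap c p1" "cinv c x1 = p1"
          using defect_domE[OF c(1,2) dom] by metis
        have p1N: "p1 \<in> points N" using p1(1) chart_domain(2)[OF N c(1)] by auto
        have "(defect c d c' has_derivative blinfun_apply (F' (x1, y1))) (at (\<gamma> t) within \<gamma> ` {0..1})"
          using F'(1)[OF dom] z has_derivative_at_withinI by metis
        from vector_derivative_diff_chain_within[OF \<gamma>(5)[OF t] this]
        have "((\<lambda>s. defect c d c' (\<gamma> s)) has_vector_derivative F' (x1, y1) (\<gamma>' t)) (at t within {0..1})"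
          by (simp add: comp_def)
        \<comment> \<open>Along the path the defect is identically 0. Derivatives are taken within
          the closed interval, so they are one-sided at its ends.\<close>
        moreover have "((\<lambda>s. defect c d c' (\<gamma> s)) has_vector_derivative 0) (at t within {0..1})"
          by (rule has_vector_derivative_transform[OF t _ has_vector_derivative_const[of 0]]) (simp add: \<gamma>(4))
        ultimately have ker: "F' (x1, y1) (fst (\<gamma>' t), snd (\<gamma>' t)) = 0"
          using vector_derivative_unique_within_closed_interval[of 0 1 t] t by simp
        have "surj (blinfun_apply (F' (x1, y1)))" "defect c d c' (x1, y1) = 0"
          using U(4) \<gamma>(3,4)[OF t] z by auto
        then obtain \<beta> where \<beta>: "(\<beta> has_vector_derivative fst (\<gamma>' t)) (at 0)" "\<beta> 0 = x1"
          "\<forall>\<^sub>F s in at 0. cinv c (\<beta> s) \<in> orbit (cinv c x1)"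
          using kernel_tangent_to_orbit[OF c dom _ F'(1)[OF dom] _ ker] by blast
        obtain e C where e: "e > 0" "\<forall>\<xi>\<in>ball (cmap c p1) e. \<forall>\<xi>'\<in>ball (cmap c p1) e.
            \<bar>u (cinv c \<xi>) - u (cinv c \<xi>')\<bar> \<le> C * norm (\<xi> - \<xi>')"
          using u(2)[unfolded locally_lipschitz_def, rule_format, OF c(1) p1(1)] by (elim exE conjE) (rule that)
        show ?thesis
        \<comment> \<open>The orbit curve is parametrised around 0 and has to be shifted to time
          \<open>t\<close>.\<close>
        proof (rule lipschitz_tangent_derivative_zero[where u = "\<lambda>\<xi>. u (cinv c \<xi>)" and \<beta> = "\<lambda>s. \<beta> (s - t)"
              and C = C and v = "fst (\<gamma>' t)", OF e(1)])
          show "\<bar>u (cinv c \<xi>) - u (cinv c \<xi>')\<bar> \<le> C * norm (\<xi> - \<xi>')"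
            if "\<xi> \<in> ball (fst (\<gamma> t)) e" "\<xi>' \<in> ball (fst (\<gamma> t)) e" for \<xi> \<xi>'
            using e(2) that z p1(2) by simp
          show "((\<lambda>s. fst (\<gamma> s)) has_vector_derivative fst (\<gamma>' t)) (at t within {0..1})"
            using bounded_linear.has_vector_derivative[OF bounded_linear_fst \<gamma>(5)[OF t]] .
          have "((\<lambda>s. s - t) has_vector_derivative 1) (at t)"
            by (auto intro!: derivative_eq_intros)
          then have "((\<beta> \<circ> (\<lambda>s. s - t)) has_vector_derivative (1::real) *\<^sub>R fst (\<gamma>' t)) (at t)"
            using \<beta>(1) by (intro vector_diff_chain_at) simp_all
          then show "((\<lambda>s. \<beta> (s - t)) has_vector_derivative fst (\<gamma>' t)) (at t)"
            by (simp add: comp_def)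
          show "\<beta> (t - t) = fst (\<gamma> t)" using \<beta>(2) z by simp
          have "\<forall>\<^sub>F s in at t. cinv c (\<beta> (s - t)) \<in> orbit p1"
            using \<beta>(3) p1(3) by (subst eventually_at_to_0) simp
          then show "\<forall>\<^sub>F s in at t. u (cinv c (\<beta> (s - t))) = u (cinv c (fst (\<gamma> t)))"
          proof eventually_elim
            case (elim s)
            then obtain h where "h \<in> points \<G>" "cinv c (\<beta> (s - t)) = h p1" by (auto simp: orbit_def)
            then show ?case using u(1) p1N p1(3) z by simp
          qed
        qed
      qed
      then obtain C where "\<And>s. s \<in> {0..1} \<Longrightarrow> u (cinv c (fst (\<gamma> s))) = C"
        using has_derivative_zero_constant[of "{0..1::real}" "\<lambda>s. u (cinv c (fst (\<gamma> s)))"] by auto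
      from this[of 0] this[of 1] have "u (cinv c (cmap c p0)) = u (cinv c x)" using \<gamma>(1,2) by simp
      then show False using u(3) cinv_cmap[OF N c(1) p0(1)] by simp
    qed
  qed
qed

end

section \<open>Transversality\<close>

text \<open>The chart data at one point that make \<open>tangent_space\<close> a vector space in
  which each chart realises every coordinate vector. In this form they can be verified for a product
  directly from its factors, since product transition maps split.\<close>

definition tangent_regular :: "('a, 'e::euclidean_space) manifold \<Rightarrow> 'a \<Rightarrow> bool" where
  "tangent_regular M p \<longleftrightarrow>
     (\<forall>c\<in>charts_at M p. cinv c (cmap c p) = p \<and> (\<exists>S. open S \<and> cmap c p \<in> S \<and> (\<forall>x\<in>S. cmap c (cinv c x) = x))) \<and>
     (\<forall>c\<in>charts_at M p. \<forall>c'\<in>charts_at M p.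
        (cmap c' \<circ> cinv c) differentiable (at (cmap c p)) \<and>
        (\<exists>S. open S \<and> cmap c p \<in> S \<and> (\<forall>x\<in>S. cinv c' (cmap c' (cinv c x)) = cinv c x)))"

lemma tangent_regularD:
  assumes "tangent_regular M p" "c \<in> charts_at M p"
  shows "cinv c (cmap c p) = p" "\<exists>S. open S \<and> cmap c p \<in> S \<and> (\<forall>x\<in>S. cmap c (cinv c x) = x)"
    and "c' \<in> charts_at M p \<Longrightarrow> ((cmap c' \<circ> cinv c) has_derivative
        frechet_derivative (cmap c' \<circ> cinv c) (at (cmap c p))) (at (cmap c p))"
    and "c' \<in> charts_at M p \<Longrightarrow> \<exists>S. open S \<and> cmap c p \<in> S \<and> (\<forall>x\<in>S. cinv c' (cmap c' (cinv c x)) = cinv c x)"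
  using assms frechet_derivative_works unfolding tangent_regular_def by blast+

lemma smooth_transition:
  assumes M: "smooth_manifold M" and c: "c \<in> charts_at M p" "c' \<in> charts_at M p"
  shows "(cmap c' \<circ> cinv c) differentiable (at (cmap c p))"
proof -
  have "smooth_on (cmap c ` (cdom c \<inter> cdom c')) (cmap c' \<circ> cinv c)"
    using M charts_atD(1)[OF c(1)] charts_atD(1)[OF c(2)] by (simp add: smooth_manifold_def)
  then obtain h' where "\<And>x. x \<in> cmap c ` (cdom c \<inter> cdom c') \<Longrightarrow>
      ((cmap c' \<circ> cinv c) has_derivative blinfun_apply (h' x)) (at x)"
    using smooth_on_C1 by blast
  moreover have "cmap c p \<in> cmap c ` (cdom c \<inter> cdom c')"
    using c by (auto dest: charts_atD)
  ultimately show ?thesis unfolding differentiable_def by blast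
qed

lemma transition_domain:
  assumes M: "smooth_manifold M" and c: "c \<in> charts_at M p" "c' \<in> charts_at M p"
  obtains S where "open S" "cmap c p \<in> S" "S \<subseteq> cmap c ` cdom c"
    "\<And>x. x \<in> S \<Longrightarrow> cmap c' (cinv c x) \<in> cmap c' ` cdom c' \<and> cinv c' (cmap c' (cinv c x)) = cinv c x"
proof (rule that[of "cmap c ` (cdom c \<inter> cdom c')"])
  note cc = charts_atD(1)[OF c(1)] charts_atD(1)[OF c(2)]
  show "open (cmap c ` (cdom c \<inter> cdom c'))"
    using chart_domain(1)[OF M cc(1)] chart_domain(1)[OF M cc(2)] by (intro open_chart_image[OF M cc(1)]) auto
  show "cmap c p \<in> cmap c ` (cdom c \<inter> cdom c')" using c by (auto dest: charts_atD)
  fix x assume "x \<in> cmap c ` (cdom c \<inter> cdom c')"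
  then show "cmap c' (cinv c x) \<in> cmap c' ` cdom c' \<and> cinv c' (cmap c' (cinv c x)) = cinv c x"
    using cinv_cmap[OF M cc(1)] cinv_cmap[OF M cc(2)] by auto
qed auto

lemma tangent_regular_product:
  assumes M: "smooth_manifold M" and M': "smooth_manifold M'"
  shows "tangent_regular (product_manifold M M') (p, q)"
  unfolding tangent_regular_def
proof (intro conjI ballI)
  fix k assume "k \<in> charts_at (product_manifold M M') (p, q)"
  then obtain c d where k: "k = prod_chart c d" and c: "c \<in> charts_at M p" "d \<in> charts_at M' q"
    unfolding charts_at_product mem_Collect_eq by (elim exE conjE) (rule that)
  note cc = charts_atD(1)[OF c(1)] charts_atD(1)[OF c(2)] charts_atD(2)[OF c(1)] charts_atD(2)[OF c(2)]
  have kk: "cmap k = map_prod (cmap c) (cmap d)" using k by simp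
  have kp: "cmap k (p, q) = (cmap c p, cmap d q)" using kk by simp
  have inv: "cinv k (x, y) = (cinv c x, cinv d y)" if "x \<in> cmap c ` cdom c" "y \<in> cmap d ` cdom d" for x y
    unfolding k by (rule cinv_prod_chart[OF M cc(1) M' cc(2) that])
  show "cinv k (cmap k (p, q)) = (p, q)"
    using cc cinv_cmap[OF M] cinv_cmap[OF M'] by (simp add: kp inv)
  show "\<exists>S. open S \<and> cmap k (p, q) \<in> S \<and> (\<forall>x\<in>S. cmap k (cinv k x) = x)"
  proof (intro exI[of _ "(cmap c ` cdom c) \<times> (cmap d ` cdom d)"] conjI ballI)
    show "open ((cmap c ` cdom c) \<times> (cmap d ` cdom d))"
      using chart_domain(3)[OF M cc(1)] chart_domain(3)[OF M' cc(2)] by (rule open_Times)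
    show "cmap k (p, q) \<in> (cmap c ` cdom c) \<times> (cmap d ` cdom d)" using cc by (simp add: kp)
    fix x assume x: "x \<in> (cmap c ` cdom c) \<times> (cmap d ` cdom d)"
    then have "fst x \<in> cmap c ` cdom c" "snd x \<in> cmap d ` cdom d" by auto
    then have "cmap k (cinv k (fst x, snd x)) = (fst x, snd x)"
      by (simp only: inv) (simp add: kk chart_inverse)
    then show "cmap k (cinv k x) = x" by simp
  qed
  fix k' assume "k' \<in> charts_at (product_manifold M M') (p, q)"
  then obtain c' d' where k': "k' = prod_chart c' d'" and c': "c' \<in> charts_at M p" "d' \<in> charts_at M' q"
    unfolding charts_at_product mem_Collect_eq by (elim exE conjE) (rule that)
  note cc' = charts_atD(1)[OF c'(1)] charts_atD(1)[OF c'(2)]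
  have kk': "cmap k' = map_prod (cmap c') (cmap d')" using k' by simp
  obtain S where S: "open S" "cmap c p \<in> S" "S \<subseteq> cmap c ` cdom c"
    "\<And>x. x \<in> S \<Longrightarrow> cmap c' (cinv c x) \<in> cmap c' ` cdom c' \<and> cinv c' (cmap c' (cinv c x)) = cinv c x"
    by (rule transition_domain[OF M c(1) c'(1)]) (rule that)
  obtain S' where S': "open S'" "cmap d q \<in> S'" "S' \<subseteq> cmap d ` cdom d"
    "\<And>x. x \<in> S' \<Longrightarrow> cmap d' (cinv d x) \<in> cmap d' ` cdom d' \<and> cinv d' (cmap d' (cinv d x)) = cinv d x"
    by (rule transition_domain[OF M' c(2) c'(2)]) (rule that)
  have SS: "open (S \<times> S')" "cmap k (p, q) \<in> S \<times> S'"
    using S(1,2) S'(1,2) by (simp_all add: kp open_Times)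
  have trans: "(cmap k' \<circ> cinv k) (x, y) = (cmap c' (cinv c x), cmap d' (cinv d y))" if "x \<in> S" "y \<in> S'" for x y
    using inv[of x y] that S(3) S'(3) by (simp add: kk' subset_iff)
  show "\<exists>S. open S \<and> cmap k (p, q) \<in> S \<and> (\<forall>x\<in>S. cinv k' (cmap k' (cinv k x)) = cinv k x)"
  proof (intro exI[of _ "S \<times> S'"] conjI SS ballI)
    fix z assume z: "z \<in> S \<times> S'"
    obtain x y where xy: "z = (x, y)" "x \<in> S" "y \<in> S'" using z by auto
    have "cinv k' (cmap k' (cinv k z)) = cinv k' (cmap c' (cinv c x), cmap d' (cinv d y))"
      using trans[OF xy(2,3)] xy(1) by (simp add: comp_def)
    also have "\<dots> = (cinv c' (cmap c' (cinv c x)), cinv d' (cmap d' (cinv d y)))"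
      unfolding k' using S(4)[OF xy(2)] S'(4)[OF xy(3)] by (intro cinv_prod_chart[OF M cc'(1) M' cc'(2)]) auto
    also have "\<dots> = cinv k z"
      using S(4)[OF xy(2)] S'(4)[OF xy(3)] xy(1) inv[OF subsetD[OF S(3) xy(2)] subsetD[OF S'(3) xy(3)]] by simp
    finally show "cinv k' (cmap k' (cinv k z)) = cinv k z" .
  qed
  have "((cmap c' \<circ> cinv c) has_derivative frechet_derivative (cmap c' \<circ> cinv c) (at (cmap c p))) (at (fst (cmap k (p, q))))"
    "((cmap d' \<circ> cinv d) has_derivative frechet_derivative (cmap d' \<circ> cinv d) (at (cmap d q))) (at (snd (cmap k (p, q))))"
    using smooth_transition[OF M c(1) c'(1)] smooth_transition[OF M' c(2) c'(2)]
    by (simp_all add: kp frechet_derivative_works)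
  note D = has_derivative_Pair[OF has_derivative_compose[OF has_derivative_fst[OF has_derivative_ident] this(1)]
      has_derivative_compose[OF has_derivative_snd[OF has_derivative_ident] this(2)]]
  have "((cmap k' \<circ> cinv k) has_derivative
      (\<lambda>z. (frechet_derivative (cmap c' \<circ> cinv c) (at (cmap c p)) (fst z),
            frechet_derivative (cmap d' \<circ> cinv d) (at (cmap d q)) (snd z)))) (at (cmap k (p, q)))"
  proof (rule has_derivative_transform_within_open[OF D SS])
    fix z assume "z \<in> S \<times> S'"
    then show "((cmap c' \<circ> cinv c) (fst z), (cmap d' \<circ> cinv d) (snd z)) = (cmap k' \<circ> cinv k) z"
      using trans[of "fst z" "snd z"] by auto
  qed
  then show "(cmap k' \<circ> cinv k) differentiable (at (cmap k (p, q)))"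
    by (rule differentiableI)
qed

lemma tangent_space_linear_combination:
  assumes reg: "tangent_regular M p" and v: "v \<in> tangent_space M p" "w \<in> tangent_space M p"
  shows "(\<lambda>c. a *\<^sub>R v c + b *\<^sub>R w c) \<in> tangent_space M p"
  unfolding tangent_space_def mem_Collect_eq
proof (intro conjI ballI allI impI)
  fix c c' assume c: "c \<in> charts_at M p" "c' \<in> charts_at M p"
  let ?D = "frechet_derivative (cmap c' \<circ> cinv c) (at (cmap c p))"
  have lin: "linear ?D"
    using tangent_regularD(3)[OF reg c] has_derivative_linear by blast
  have "v c' = ?D (v c)" "w c' = ?D (w c)"
    using v c unfolding tangent_space_def by blast+
  then show "a *\<^sub>R v c' + b *\<^sub>R w c' = ?D (a *\<^sub>R v c + b *\<^sub>R w c)"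
    by (simp add: linear_add[OF lin] linear_scale[OF lin])
next
  fix c assume "c \<notin> charts_at M p"
  then have "v c = 0" "w c = 0" using v unfolding tangent_space_def by blast+
  then show "a *\<^sub>R v c + b *\<^sub>R w c = 0" by simp
qed

text \<open>The cocycle identity of transition derivatives, an instance of the chain rule, makes the
  family of coordinates a tangent vector. It provides vectors on which a covector given in one chart
  can be tested.\<close>

lemma coord_vec_tangent:
  assumes reg: "tangent_regular M p" and c: "c \<in> charts_at M p"
  shows "coord_vec M c p u \<in> tangent_space M p" "coord_vec M c p u c = u"
proof -
  let ?t = "\<lambda>c c'. cmap c' \<circ> cinv c"
  have chain: "frechet_derivative (?t c c'') (at (cmap c p)) u =
      frechet_derivative (?t c' c'') (at (cmap c' p)) (frechet_derivative (?t c c') (at (cmap c p)) u)"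
    if c': "c' \<in> charts_at M p" "c'' \<in> charts_at M p" for c' c''
  proof -
    have "?t c c' (cmap c p) = cmap c' p"
      using tangent_regularD(1)[OF reg c] by simp
    then have "(?t c' c'' has_derivative frechet_derivative (?t c' c'') (at (cmap c' p))) (at (?t c c' (cmap c p)))"
      using tangent_regularD(3)[OF reg c'] by simp
    note D = has_derivative_compose[OF tangent_regularD(3)[OF reg c c'(1)] this]
    obtain S where S: "open S" "cmap c p \<in> S" "\<And>x. x \<in> S \<Longrightarrow> cinv c' (cmap c' (cinv c x)) = cinv c x"
      using tangent_regularD(4)[OF reg c c'(1)] by blast
    have "(?t c c'' has_derivative (\<lambda>h. frechet_derivative (?t c' c'') (at (cmap c' p))
        (frechet_derivative (?t c c') (at (cmap c p)) h))) (at (cmap c p))"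
      by (rule has_derivative_transform_within_open[OF D S(1,2)]) (simp add: S(3))
    from has_derivative_unique[OF this tangent_regularD(3)[OF reg c c'(2)]] show ?thesis by metis
  qed
  show "coord_vec M c p u \<in> tangent_space M p"
    unfolding tangent_space_def mem_Collect_eq
  proof (intro conjI ballI allI impI)
    fix c' c'' assume c': "c' \<in> charts_at M p" "c'' \<in> charts_at M p"
    have "coord_vec M c p u c' = frechet_derivative (?t c c') (at (cmap c p)) u"
      "coord_vec M c p u c'' = frechet_derivative (?t c c'') (at (cmap c p)) u"
      using c' by (simp_all add: coord_vec_def)
    then show "coord_vec M c p u c'' = frechet_derivative (?t c' c'') (at (cmap c' p)) (coord_vec M c p u c')"
      using chain[OF c'] by (simp only:)
  qed (simp only: coord_vec_def if_False)
  obtain S where S: "open S" "cmap c p \<in> S" "\<And>x. x \<in> S \<Longrightarrow> cmap c (cinv c x) = x"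
    using tangent_regularD(2)[OF reg c] by blast
  have "(?t c c has_derivative (\<lambda>h. h)) (at (cmap c p))"
    by (rule has_derivative_transform_within_open[OF has_derivative_ident S(1,2)]) (simp add: S(3))
  from has_derivative_unique[OF this tangent_regularD(3)[OF reg c c]]
  have "frechet_derivative (?t c c) (at (cmap c p)) u = u" by metis
  then show "coord_vec M c p u c = u" using c by (simp only: coord_vec_def if_True)
qed

section \<open>From transversality to isolated fixed orbits\<close>

context equivariant_map
begin

lemma transversal_imp_surj:
  assumes transversal:
      "\<forall>(y, \<eta>) \<in> conormal (product_manifold N \<G>) (product_manifold N N) (\<lambda>(p, g). (g p, f p))
                 \<inter> conormal N (product_manifold N N) (\<lambda>p. (p, p)).
         \<eta> = (\<lambda>_. 0)"
    and p0: "p0 \<in> points N" and g0: "g0 \<in> points \<G>" and eq: "f p0 = g0 p0"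
  obtains c d c' L where "c \<in> charts N" "d \<in> charts \<G>" "c' \<in> charts N"
    "p0 \<in> cdom c" "g0 \<in> cdom d" "f p0 \<in> cdom c'"
    "(defect c d c' has_derivative L) (at (cmap c p0, cmap d g0))" "surj L"
proof -
  let ?X = "product_manifold N \<G>" and ?Y = "product_manifold N N"
  let ?\<iota> = "\<lambda>(p, g). (g p, f p)" and ?\<Delta> = "\<lambda>p. (p, p)"
  define q where "q = f p0"
  have q: "q \<in> points N" using action_points[OF g0 p0] eq by (simp add: q_def)
  \<comment> \<open>The chart in which \<open>differential\<close> computes. Every chart of the
    product splits, so \<open>c\<close> and \<open>d\<close> are read off from it rather than
    chosen.\<close>
  define k where "k = (SOME k. k \<in> charts_at ?X (p0, g0))"
  obtain c0 d0 where "c0 \<in> charts_at N p0" "d0 \<in> charts_at \<G> g0"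
    using charts_at_nonempty[OF N p0] charts_at_nonempty[OF \<G> g0] by metis
  then have "prod_chart c0 d0 \<in> charts_at ?X (p0, g0)"
    unfolding charts_at_product by blast
  then have "k \<in> charts_at ?X (p0, g0)" unfolding k_def by (rule someI)
  then obtain c d where k: "k = prod_chart c d" and cd: "c \<in> charts_at N p0" "d \<in> charts_at \<G> g0"
    unfolding charts_at_product mem_Collect_eq by (elim exE conjE) (rule that)
  obtain c' where c': "c' \<in> charts_at N q" using charts_at_nonempty[OF N q] by metis
  note C = charts_atD(1)[OF cd(1)] charts_atD(1)[OF cd(2)] charts_atD(1)[OF c']
  have P: "p0 \<in> cdom c" "g0 \<in> cdom d" "g0 p0 \<in> cdom c'" "f p0 \<in> cdom c'"
    using cd c' eq by (auto simp: q_def dest: charts_atD)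
  let ?z0 = "(cmap c p0, cmap d g0)"
  let ?A = "frechet_derivative (act_rep c d c') (at ?z0)"
  let ?f = "cmap c' \<circ> f \<circ> cinv c"
  let ?B = "frechet_derivative ?f (at (cmap c p0))"
  have dom: "?z0 \<in> defect_dom c d c'" by (rule defect_domI[OF P])
  obtain A' where "\<And>z. z \<in> act_dom c d c' \<Longrightarrow> (act_rep c d c' has_derivative blinfun_apply (A' z)) (at z)"
    using smooth_on_C1[OF smooth_act_rep[OF C]] by blast
  then have A: "(act_rep c d c' has_derivative ?A) (at ?z0)"
    using act_domI[OF P(1-3)] frechet_derivative_works differentiableI by blast
  have B: "(?f has_derivative ?B) (at (fst ?z0))"
    using smooth_map_local_rep(3)[OF N N f C(1,3) P(1,4)] by simp
  note B1 = has_derivative_compose[OF has_derivative_fst[OF has_derivative_ident] B]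
  define L where "L h = ?A h - ?B (fst h)" for h
  have L: "(defect c d c' has_derivative L) (at ?z0)"
    unfolding defect_def[abs_def] L_def[abs_def] using has_derivative_diff[OF A B1] .
  let ?K = "prod_chart c' c'"
  have K: "?K \<in> charts_at ?Y (q, q)" unfolding charts_at_product using c' by blast
  have regY: "tangent_regular ?Y (q, q)" by (rule tangent_regular_product[OF N N])
  have d\<iota>: "fst (differential ?X ?Y ?\<iota> (p0, g0) v ?K) - snd (differential ?X ?Y ?\<iota> (p0, g0) v ?K) = L (v k)" for v
  proof -
    have "?\<iota> (p0, g0) = (q, q)" using eq by (simp add: q_def)
    then have *: "differential ?X ?Y ?\<iota> (p0, g0) v ?K =
        frechet_derivative (cmap ?K \<circ> ?\<iota> \<circ> cinv k) (at (cmap k (p0, g0))) (v k)"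
      using K by (simp add: differential_def Let_def k_def)
    have kz: "cmap k (p0, g0) = ?z0" using k by simp
    have "((\<lambda>z. (act_rep c d c' z, ?f (fst z))) has_derivative (\<lambda>h. (?A h, ?B (fst h)))) (at ?z0)"
      by (rule has_derivative_Pair[OF A B1])
    then have "((cmap ?K \<circ> ?\<iota> \<circ> cinv k) has_derivative (\<lambda>h. (?A h, ?B (fst h)))) (at ?z0)"
    proof (rule has_derivative_transform_within_open[OF _ open_defect_dom[OF C] dom])
      fix z assume z: "z \<in> defect_dom c d c'"
      obtain x y where xy: "z = (x, y)" by fastforce
      then have "x \<in> cmap c ` cdom c" "y \<in> cmap d ` cdom d" "(x, y) \<in> act_dom c d c'"
        using z act_domE[OF C(1,2), of x y c'] by (auto simp: defect_dom_def)
      then show "(act_rep c d c' z, ?f (fst z)) = (cmap ?K \<circ> ?\<iota> \<circ> cinv k) z"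
        using cinv_prod_chart[OF N C(1) \<G> C(2)] act_rep_eq[OF C(1,2)] xy k by simp
    qed
    then have "frechet_derivative (cmap ?K \<circ> ?\<iota> \<circ> cinv k) (at ?z0) = (\<lambda>h. (?A h, ?B (fst h)))"
      by (rule frechet_derivative_at[symmetric])
    then show ?thesis using * kz by (simp add: L_def)
  qed
  have d\<Delta>: "fst (differential N ?Y ?\<Delta> q v ?K) = snd (differential N ?Y ?\<Delta> q v ?K)" for v
  proof -
    \<comment> \<open>Again the chart selected by \<open>differential\<close>; it may differ from
      \<open>c'\<close>, but both components of the diagonal pass through the same transition
      map.\<close>
    define c2 where "c2 = (SOME c. c \<in> charts_at N q)"
    have c2: "c2 \<in> charts_at N q" unfolding c2_def using c' by (rule someI)
    have *: "differential N ?Y ?\<Delta> q v ?K = frechet_derivative (cmap ?K \<circ> ?\<Delta> \<circ> cinv c2) (at (cmap c2 q)) (v c2)"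
      using K by (simp add: differential_def Let_def c2_def)
    have "((cmap c' \<circ> cinv c2) has_derivative frechet_derivative (cmap c' \<circ> cinv c2) (at (cmap c2 q))) (at (cmap c2 q))"
      using smooth_transition[OF N c2 c'] by (simp add: frechet_derivative_works)
    from has_derivative_Pair[OF this this]
    have "((cmap ?K \<circ> ?\<Delta> \<circ> cinv c2) has_derivative (\<lambda>h. (frechet_derivative (cmap c' \<circ> cinv c2) (at (cmap c2 q)) h,
        frechet_derivative (cmap c' \<circ> cinv c2) (at (cmap c2 q)) h))) (at (cmap c2 q))"
      by (simp add: comp_def)
    from frechet_derivative_at[OF this, symmetric] show ?thesis using * by simp
  qed
  have "surj L"
  proof (rule ccontr)
    assume "\<not> surj L"
    have "linear L" using L has_derivative_linear by blast
    then have sub: "subspace (range L)" by (intro linear_subspace_image) auto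
    then have "span (range L) \<noteq> UNIV" using \<open>\<not> surj L\<close> by (metis span_eq_iff)
    then have "dim (range L) < DIM('e)"
      using dim_eq_full[of "range L"] dim_subset_UNIV[of "range L"] by linarith
    then obtain \<xi> where \<xi>: "\<xi> \<noteq> 0" "\<And>y. y \<in> span (range L) \<Longrightarrow> orthogonal \<xi> y"
      using orthogonal_to_subspace_exists by blast
    then have \<xi>L: "\<xi> \<bullet> L h = 0" for h by (simp add: orthogonal_def span_base)
    \<comment> \<open>The covector \<open>(\<xi>, -\<xi>)\<close> in the chart \<open>?K\<close>: it
      sees only the difference of the two components, which is 0 along the diagonal and a value of
      \<open>L\<close> along \<open>?\<iota>\<close>. The value 0 off the tangent space is the
      normalisation in \<open>cotangent_space\<close>.\<close>
    define \<eta> where "\<eta> w = (if w \<in> tangent_space ?Y (q, q) then \<xi> \<bullet> (fst (w ?K) - snd (w ?K)) else 0)" for w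
    have cot: "\<eta> \<in> cotangent_space ?Y (q, q)"
      unfolding cotangent_space_def linear_functional_on_def mem_Collect_eq
    proof (intro conjI ballI allI impI)
      fix v w a b assume vw: "v \<in> tangent_space ?Y (q, q)" "w \<in> tangent_space ?Y (q, q)"
      show "\<eta> (\<lambda>c. a *\<^sub>R v c + b *\<^sub>R w c) = a * \<eta> v + b * \<eta> w"
        using vw tangent_space_linear_combination[OF regY vw]
        by (simp add: \<eta>_def inner_diff_right inner_add_right algebra_simps)
    qed (simp add: \<eta>_def)
    have "((q, q), \<eta>) \<in> conormal ?X ?Y ?\<iota>"
      unfolding conormal_def mem_Collect_eq case_prod_conv
    proof (intro conjI cot bexI)
      show "(p0, g0) \<in> points ?X" using p0 g0 by (simp add: product_manifold_def)
      show "(q, q) = ?\<iota> (p0, g0)" using eq by (simp add: q_def)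
      show "pullback_covector ?X ?Y ?\<iota> (p0, g0) \<eta> = (\<lambda>_. 0)"
        unfolding pullback_covector_def \<eta>_def d\<iota> \<xi>L by auto
    qed
    moreover have "((q, q), \<eta>) \<in> conormal N ?Y ?\<Delta>"
      unfolding conormal_def mem_Collect_eq case_prod_conv
    proof (intro conjI cot bexI)
      show "q \<in> points N" by (rule q)
      show "(q, q) = ?\<Delta> q" by simp
      show "pullback_covector N ?Y ?\<Delta> q \<eta> = (\<lambda>_. 0)"
        unfolding pullback_covector_def \<eta>_def d\<Delta> by auto
    qed
    ultimately have "\<eta> = (\<lambda>_. 0)" using transversal by blast
    \<comment> \<open>Testing on the vector with coordinates \<open>(\<xi>, 0)\<close> gives the
      squared norm of \<xi>, which is not 0.\<close>
    moreover have "\<eta> (coord_vec ?Y ?K (q, q) (\<xi>, 0)) = \<xi> \<bullet> \<xi>"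
      using coord_vec_tangent[OF regY K] by (simp add: \<eta>_def)
    ultimately show False using \<xi>(1) by simp
  qed
  then show thesis using that C P L by blast
qed

text \<open>Near a pair \<open>(p0, g0)\<close> that does not solve \<open>f p = g p\<close> there
  are no solutions by continuity; near a solution, all solutions lie over the orbit of
  \<open>p0\<close>. Compactness of the group merges these neighbourhoods into one of
  \<open>p0\<close> alone.\<close>

lemma fixed_orbit_isolated:
  assumes transversal:
      "\<forall>(y, \<eta>) \<in> conormal (product_manifold N \<G>) (product_manifold N N) (\<lambda>(p, g). (g p, f p))
                 \<inter> conormal N (product_manifold N N) (\<lambda>p. (p, p)).
         \<eta> = (\<lambda>_. 0)"
    and p0: "p0 \<in> points N"
  obtains U where "openin (mtop N) U" "p0 \<in> U" "\<And>p. p \<in> U \<Longrightarrow> f p \<in> orbit p \<Longrightarrow> p \<in> orbit p0"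
proof -
  obtain c0 where c0: "c0 \<in> charts N" "p0 \<in> cdom c0" using chart_around[OF N p0] by metis
  \<comment> \<open>The charts obtained at different \<open>g0\<close> vary, so all neighbourhoods
    of \<open>p0\<close> are measured by balls in one fixed chart \<open>c0\<close>.\<close>
  let ?P = "\<lambda>e g. \<forall>x\<in>ball (cmap c0 p0) e. f (cinv c0 x) = g (cinv c0 x) \<longrightarrow> cinv c0 x \<in> orbit p0"
  have nhds: "\<exists>W V. openin (mtop N) W \<and> openin (mtop \<G>) V \<and> p0 \<in> W \<and> g0 \<in> V \<and>
      (\<forall>p\<in>W. \<forall>g\<in>V. f p = g p \<longrightarrow> p \<in> orbit p0)" if g0: "g0 \<in> points \<G>" for g0
  proof (cases "f p0 = g0 p0")
    case True
    obtain c d c' L where c: "c \<in> charts N" "d \<in> charts \<G>" "c' \<in> charts N"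
      and P: "p0 \<in> cdom c" "g0 \<in> cdom d" "f p0 \<in> cdom c'"
      and L: "(defect c d c' has_derivative L) (at (cmap c p0, cmap d g0))" "surj L"
      by (rule transversal_imp_surj[OF transversal p0 g0 True]) (rule that)
    obtain U where U: "open U" "(cmap c p0, cmap d g0) \<in> U" "U \<subseteq> defect_dom c d c'"
      "\<And>x y. (x, y) \<in> U \<Longrightarrow> defect c d c' (x, y) = 0 \<Longrightarrow> cinv c x \<in> orbit p0"
      by (rule zero_set_in_orbit[OF c P(1,2) True P(3) L]) (rule that)
    obtain A B where AB: "open A" "open B" "(cmap c p0, cmap d g0) \<in> A \<times> B" "A \<times> B \<subseteq> U"
      by (rule open_prod_elim[OF U(1,2)]) (rule that)
    show ?thesis
    proof (intro exI conjI ballI impI)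
      show "openin (mtop N) {p \<in> cdom c. cmap c p \<in> A}" "openin (mtop \<G>) {g \<in> cdom d. cmap d g \<in> B}"
        by (rule openin_chart_vimage[OF N c(1) AB(1)], rule openin_chart_vimage[OF \<G> c(2) AB(2)])
      show "p0 \<in> {p \<in> cdom c. cmap c p \<in> A}" "g0 \<in> {g \<in> cdom d. cmap d g \<in> B}" using P AB(3) by auto
      fix p g assume p: "p \<in> {p \<in> cdom c. cmap c p \<in> A}" and g: "g \<in> {g \<in> cdom d. cmap d g \<in> B}"
        and eq: "f p = g p"
      have inU: "(cmap c p, cmap d g) \<in> U" using p g AB(4) by auto
      have inv: "cinv c (cmap c p) = p" "cinv d (cmap d g) = g"
        using p g cinv_cmap[OF N c(1)] cinv_cmap[OF \<G> c(2)] by auto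
      have "(cmap c p, cmap d g) \<in> act_dom c d c'"
        using inU U(3) by (auto simp: defect_dom_def)
      then have "g p \<in> cdom c'" using act_domE(3)[OF c(1,2)] inv by metis
      then have "defect c d c' (cmap c p, cmap d g) = 0"
        using defect_eq[OF c(1,2)] p g eq by simp
      then show "p \<in> orbit p0" using U(4)[OF inU] inv(1) by simp
    qed
  next
    case False
    let ?XX = "prod_topology (mtop N) (mtop \<G>)"
    have "continuous_map ?XX (mtop N) (\<lambda>z. f (fst z))"
      using continuous_map_compose[OF continuous_map_fst, of "mtop N" "mtop N" f "mtop \<G>"] f
      by (simp add: smooth_map_def comp_def)
    then have "closedin ?XX {z \<in> topspace ?XX. f (fst z) = (\<lambda>(p, g). g p) z}"
      using N by (intro closedin_continuous_maps_eq[OF _ _ continuous_action]) (auto simp: smooth_manifold_def)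
    then have "openin ?XX (topspace ?XX - {z \<in> topspace ?XX. f (fst z) = (\<lambda>(p, g). g p) z})"
      by (rule openin_diff[OF openin_topspace])
    moreover have "(p0, g0) \<in> topspace ?XX - {z \<in> topspace ?XX. f (fst z) = (\<lambda>(p, g). g p) z}"
      using False p0 g0 by simp
    ultimately have "\<exists>W V. openin (mtop N) W \<and> openin (mtop \<G>) V \<and> p0 \<in> W \<and> g0 \<in> V \<and>
        W \<times> V \<subseteq> topspace ?XX - {z \<in> topspace ?XX. f (fst z) = (\<lambda>(p, g). g p) z}"
      by (rule openin_prod_topology_alt[THEN iffD1, rule_format])
    then show ?thesis
    proof (elim exE conjE, intro exI conjI ballI impI)
      fix W V p g
      assume "W \<times> V \<subseteq> topspace ?XX - {z \<in> topspace ?XX. f (fst z) = (\<lambda>(p, g). g p) z}"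
        "p \<in> W" "g \<in> V" "f p = g p"
      then show "p \<in> orbit p0" by auto
    qed
  qed
  obtain e where e: "e > 0" "\<And>g. g \<in> points \<G> \<Longrightarrow> ?P e g"
  proof (rule compact_space_uniform_radius[OF compact_\<G>, of ?P])
    fix g0 assume "g0 \<in> points \<G>"
    from nhds[OF this] obtain W V where "openin (mtop N) W \<and> openin (mtop \<G>) V \<and> p0 \<in> W \<and> g0 \<in> V \<and>
      (\<forall>p\<in>W. \<forall>g\<in>V. f p = g p \<longrightarrow> p \<in> orbit p0)" by (elim exE)
    then have W: "openin (mtop N) W" "p0 \<in> W" and V: "openin (mtop \<G>) V" "g0 \<in> V"
      and WV: "\<And>p g. p \<in> W \<Longrightarrow> g \<in> V \<Longrightarrow> f p = g p \<Longrightarrow> p \<in> orbit p0" by auto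
    obtain e where "e > 0" "\<And>x. x \<in> ball (cmap c0 p0) e \<Longrightarrow> cinv c0 x \<in> W"
      by (rule chart_ball[OF N c0(1) W c0(2)]) (rule that)
    then have "e > 0" "\<forall>g\<in>V. ?P e g" using WV by blast+
    then show "\<exists>V e. openin (mtop \<G>) V \<and> g0 \<in> V \<and> e > 0 \<and> (\<forall>g\<in>V. ?P e g)" using V by blast
  next
    fix g e e' assume "?P e g" "0 < e'" "e' \<le> (e::real)"
    then show "?P e' g" by simp
  qed (rule that)
  show thesis
  proof
    show "openin (mtop N) {p \<in> cdom c0. cmap c0 p \<in> ball (cmap c0 p0) e}"
      by (rule openin_chart_vimage[OF N c0(1) open_ball])
    show "p0 \<in> {p \<in> cdom c0. cmap c0 p \<in> ball (cmap c0 p0) e}" using c0(2) e(1) by simp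
    fix p assume p: "p \<in> {p \<in> cdom c0. cmap c0 p \<in> ball (cmap c0 p0) e}" and "f p \<in> orbit p"
    then obtain g where g: "g \<in> points \<G>" "f p = g p" by (auto simp: orbit_def)
    have "cinv c0 (cmap c0 p) = p" using cinv_cmap[OF N c0(1)] p by simp
    then show "p \<in> orbit p0" using e(2)[OF g(1), rule_format, of "cmap c0 p"] p g(2) by simp
  qed
qed

lemma fixed_orbits_discrete:
  assumes transversal:
      "\<forall>(y, \<eta>) \<in> conormal (product_manifold N \<G>) (product_manifold N N) (\<lambda>(p, g). (g p, f p))
                 \<inter> conormal N (product_manifold N N) (\<lambda>p. (p, p)).
         \<eta> = (\<lambda>_. 0)"
  defines "F \<equiv> {Y \<in> orbits (mtop N) (points \<G>). f ` Y = Y}"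
  shows "subtopology (orbit_space (mtop N) (points \<G>)) F = discrete_topology F"
proof -
  let ?B = "orbit_space (mtop N) (points \<G>)"
  have orbits: "orbits (mtop N) (points \<G>) = orbit ` points N"
    by (simp add: orbits_def orbit_def)
  have "openin (subtopology ?B F) {Y}" if Y: "Y \<in> F" for Y
  proof -
    obtain p0 where p0: "p0 \<in> points N" "Y = orbit p0" using Y orbits by (auto simp: F_def)
    obtain U where U: "openin (mtop N) U" "p0 \<in> U" "\<And>p. p \<in> U \<Longrightarrow> f p \<in> orbit p \<Longrightarrow> p \<in> orbit p0"
      by (rule fixed_orbit_isolated[OF transversal p0(1)]) (rule that)
    have UN: "U \<subseteq> points N" using U(1) by (rule openin_subset)
    have "openin ?B (orbit ` U)"
      unfolding openin_orbit_space orbits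
    proof (intro conjI image_mono UN)
      \<comment> \<open>The saturation of \<open>U\<close> is a union of preimages of
        \<open>U\<close> under group elements, hence open; so the projection to the orbit space
        sends \<open>U\<close> to an open set.\<close>
      have "{p \<in> points N. orbit p \<in> orbit ` U} = (\<Union>h\<in>points \<G>. {p \<in> points N. h p \<in> U})"
      proof (intro equalityI subsetI)
        fix p assume "p \<in> {p \<in> points N. orbit p \<in> orbit ` U}"
        then obtain p' where p': "p \<in> points N" "p' \<in> U" "orbit p = orbit p'" by auto
        then have "p' \<in> orbit p" using orbit_self UN by auto
        then obtain h where "h \<in> points \<G>" "p' = h p" unfolding orbit_def by blast
        then show "p \<in> (\<Union>h\<in>points \<G>. {p \<in> points N. h p \<in> U})" using p'(1,2) by blast
      next
        fix p assume "p \<in> (\<Union>h\<in>points \<G>. {p \<in> points N. h p \<in> U})"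
        then obtain h where h: "h \<in> points \<G>" "p \<in> points N" "h p \<in> U" by blast
        then show "p \<in> {p \<in> points N. orbit p \<in> orbit ` U}"
          using orbit_action[OF h(1,2)] by (auto intro!: image_eqI[of "orbit p" orbit "h p"])
      qed
      moreover have "openin (mtop N) (\<Union>h\<in>points \<G>. {p \<in> points N. h p \<in> U})"
        using openin_continuous_map_preimage[OF continuous_element U(1)] by (intro openin_Union) auto
      ultimately show "openin (mtop N) {p \<in> points N. (\<lambda>g. g p) ` points \<G> \<in> orbit ` U}"
        by (simp add: orbit_def)
    qed
    \<comment> \<open>A fixed orbit that meets \<open>U\<close> contains a point \<open>p\<close> of
      \<open>U\<close> with \<open>f p\<close> in the orbit of \<open>p\<close>, so it is the orbit
      of \<open>p0\<close>.\<close>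
    moreover have "orbit ` U \<inter> F = {Y}"
    proof (intro equalityI subsetI)
      fix Z assume "Z \<in> orbit ` U \<inter> F"
      then obtain p where p: "p \<in> U" "Z = orbit p" "f ` orbit p = orbit p" by (auto simp: F_def)
      then have "f p \<in> orbit p" using orbit_self UN by blast
      then have "p \<in> orbit p0" using U(3) p(1) by blast
      then show "Z \<in> {Y}" using p(2) p0 orbit_action[of _ p0] by (auto simp: orbit_def[of p0])
    qed (use U(2) p0(2) Y in auto)
    ultimately show ?thesis unfolding openin_subtopology by metis
  qed
  moreover have "topspace (subtopology ?B F) = F"
    by (auto simp: topspace_orbit_space F_def)
  ultimately show ?thesis
    by (metis discrete_topology_unique)
qed

end

theorem theorem1p23:
  fixes N :: "('a, 'e::euclidean_space) manifold"
    and T :: "'a \<Rightarrow> ('a, 'e) tvec"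
    and \<g> :: "'a \<Rightarrow> ('a, 'e) tvec \<Rightarrow> ('a, 'e) tvec \<Rightarrow> real"
    and \<Phi> :: "real \<Rightarrow> 'a \<Rightarrow> 'a"
    and G :: "('a \<Rightarrow> 'a) set"
    and \<G> :: "('a \<Rightarrow> 'a, 'h::euclidean_space) manifold"
    and f :: "'a \<Rightarrow> 'a"
  assumes N: "closed_manifold N"
    and T: "smooth_vector_field N T" "\<forall>p\<in>points N. T p \<noteq> (\<lambda>_. 0)"
    and flow: "global_flow N T \<Phi>"
    and metric: "riemannian_metric N \<g>" "\<forall>t. restrict (\<Phi> t) (points N) \<in> isometries N \<g>"
    and G: "G = flow_closure N \<g> \<Phi>"
    and G_lie: "mtop \<G> = subtopology (isometry_topology N \<g>) G"
      "lie_group (BijGroup (points N)\<lparr>carrier := G\<rparr>) \<G>"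
      "comm_group (BijGroup (points N)\<lparr>carrier := G\<rparr>)"
      "compact_space (mtop \<G>)" "connected_space (mtop \<G>)"
    and action: "smooth_map (product_manifold N \<G>) N (\<lambda>(p, g). g p)"
    and f: "smooth_map N N f" "\<forall>p\<in>points N. differential N N f p (T p) = T (f p)"
    and transversal:
      "\<forall>(y, \<eta>) \<in> conormal (product_manifold N \<G>) (product_manifold N N) (\<lambda>(p, g). (g p, f p))
                 \<inter> conormal N (product_manifold N N) (\<lambda>p. (p, p)).
         \<eta> = (\<lambda>_. 0)"
    and Fix: "Fix = {Y \<in> orbits (mtop N) G. f ` Y = Y}"
  shows "subtopology (orbit_space (mtop N) G) Fix = discrete_topology Fix"
proof -
  let ?\<Gamma> = "BijGroup (points N)\<lparr>carrier := G\<rparr>"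
  have M: "smooth_manifold N" using N by (simp add: closed_manifold_def)
  have M\<G>: "smooth_manifold \<G>" and pts: "points \<G> = G"
    using G_lie(2) by (simp_all add: lie_group_def)
  interpret \<Gamma>: comm_group ?\<Gamma> by (rule G_lie(3))
  \<comment> \<open>The closure is taken inside the isometry group, so its elements are again
    isometries, in particular smooth bijections.\<close>
  have "G \<subseteq> topspace (isometry_topology N \<g>)"
    unfolding G flow_closure_def by (rule closure_of_subset_topspace)
  then have iso: "g \<in> isometries N \<g>" if "g \<in> G" for g
    using that by (auto simp: isometry_topology_def)
  then have Bij: "g \<in> Bij (points N)" if "g \<in> G" for g
    using that by (auto simp: isometries_def)
  have mult: "g \<otimes>\<^bsub>?\<Gamma>\<^esub> h = compose (points N) g h" if "g \<in> G" "h \<in> G" for g h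
    using Bij that by (simp add: BijGroup_def)
  have one: "\<one>\<^bsub>?\<Gamma>\<^esub> = (\<lambda>x\<in>points N. x)" by (simp add: BijGroup_def)
  \<comment> \<open>Equations in the group are equations between maps normalised off
    \<open>N\<close>; evaluating them at points of \<open>N\<close> gives the pointwise laws of the
    locale.\<close>
  interpret equivariant_map N \<G> f
  proof
    show "smooth_manifold N" "smooth_manifold \<G>" "compact_space (mtop \<G>)"
      "smooth_map (product_manifold N \<G>) N (\<lambda>(p, g). g p)" "smooth_map N N f"
      by (fact M M\<G> G_lie(4) action f(1))+
    show "smooth_map N N g" if "g \<in> points \<G>" for g
      using iso that by (simp add: pts isometries_def)
    show "\<exists>e\<in>points \<G>. \<forall>p\<in>points N. e p = p"
      using \<Gamma>.one_closed by (intro bexI[of _ "\<one>\<^bsub>?\<Gamma>\<^esub>"]) (simp_all add: one pts)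
    show "\<exists>k\<in>points \<G>. \<forall>p\<in>points N. k p = g (h p)" if "g \<in> points \<G>" "h \<in> points \<G>" for g h
      using \<Gamma>.m_closed[of g h] that mult[of g h]
      by (intro bexI[of _ "g \<otimes>\<^bsub>?\<Gamma>\<^esub> h"]) (simp_all add: pts compose_def)
    show "\<exists>k\<in>points \<G>. \<forall>p\<in>points N. k (g p) = p" if "g \<in> points \<G>" for g
    proof -
      have g: "g \<in> G" using that by (simp add: pts)
      obtain k where k: "k \<in> G" "k \<otimes>\<^bsub>?\<Gamma>\<^esub> g = \<one>\<^bsub>?\<Gamma>\<^esub>"
        using \<Gamma>.l_inv_ex[of g] g by auto
      then have "compose (points N) k g = (\<lambda>x\<in>points N. x)" using mult[OF k(1) g] one by simp
      then have "k (g p) = p" if "p \<in> points N" for p using that by (metis compose_eq restrict_apply')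
      then show ?thesis using k(1) by (auto simp: pts)
    qed
    show "g (h p) = h (g p)" if "g \<in> points \<G>" "h \<in> points \<G>" "p \<in> points N" for g h p
      using \<Gamma>.m_comm[of g h] that mult[of g h] mult[of h g] by (simp add: pts) (metis compose_eq)
    show "f (g p) = g (f p)" if "g \<in> points \<G>" "p \<in> points N" for g p
    proof (rule map_commutes_with_flow_closure[OF M])
      show "continuous_map (mtop N) (mtop N) f" using f(1) by (simp add: smooth_map_def)
      show "f (\<Phi> t p) = \<Phi> t (f p)" if "p \<in> points N" for t p
        by (rule map_commutes_with_flow[OF M T(1) flow f that])
      show "g \<in> flow_closure N \<g> \<Phi>" using that(1) pts G by simp
    qed (rule that)
  qed
  show ?thesis
    using fixed_orbits_discrete[OF transversal] unfolding pts Fix .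
qed

end
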